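(* Let $\underline{x} = (x_1, x_2)^T \in \mathbb{F}_q((T^{-1}))^2$ with $x_2 \neq 0$ and such that $\xi = x_1/x_2 \notin \mathbb{F}_q(T)$. (1) $\mu(\underline{x}, \underline{0}) = 1$ and $\hat{\mu}(\underline{x}, \underline{0}) = 1/\omega(\xi)$. (2) If $\underline{y} = (y_1,y_2)^T \in \mathbb{F}_q((T^{-1}))^2$ with $y_2\neq 0$ has slope $y = y_1/y_2 \in \mathbb{F}_q(T)$, then \[ \mu(\underline{x}, \underline{y}) = \frac{\omega(\xi)}{\omega(\xi)+1} \quad\text{and}\quad \hat{\mu}(\underline{x}, \underline{y}) = \frac{1}{\omega(\xi)+1}. \] (3) If $\underline{y} = (y_1,y_2)^T$ with $y_2\neq0$ has slope $y = y_1/y_2 \notin \mathbb{F}_q(T)$, then \[ \mu(\underline{x}, \underline{y}) \geq \frac{1}{3} \quad\text{and}\quad \hat{\mu}(\underline{x}, \underline{y}) \geq \frac{\omega(y)+1}{2(2\omega(y)+1)\,\omega(\xi)} \geq \frac{1}{4\omega(\xi)}. \]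
   Context: $\mathbb{F}_q((T^{-1}))$ is the field of formal Laurent series in $T^{-1}$ over the finite field $\mathbb{F}_q$, with absolute value $|x| = q^{\deg x}$ ($|0|=0$), where $\deg x$ is the largest $n$ with nonzero coefficient of $T^{n}$. For $x$ in this field, $\|x\|$ is the distance $|x-P|$ from $x$ to the nearest polynomial $P\in\mathbb{F}_q[T]$. For vectors and matrices, $|\cdot|$ is the maximum of the absolute values of the entries. $\mathrm{SL}_2(\mathbb{F}_q[T])$ acts on $\mathbb{F}_q((T^{-1}))^2$ by matrix multiplication on column vectors. For $\xi \in \mathbb{F}_q((T^{-1}))\setminus\mathbb{F}_q(T)$, the irrationality exponent $\omega(\xi)$ is the supremum of real $\omega$ such that for arbitrarily large real $H$ there exists $Q\in\mathbb{F}_q[T]\setminus\{0\}$ with $|Q|\le H$ and $\|Q\xi\|\le H^{-\omega}$ (it satisfies $\omega(\xi)\ge1$ and may be $+\infty$; expressions are interpreted with the natural conventions, e.g. $1/\infty = 0$, $\omega/(\omega+1)=1$ for $\omega=\infty$). For $\underline{x},\underline{y}\in\mathbb{F}_q((T^{-1}))^2$, $\mu(\underline{x},\underline{y})$ is the supremum of $\mu$ such that $|\gamma\underline{x}-\underline{y}|\le|\gamma|^{-\mu}$ has infinitely many solutions $\gamma\in\mathrm{SL}_2(\mathbb{F}_q[T])$, and $\hat\mu(\underline{x},\underline{y})$ is the supremum of $\hat\mu$ such that for all sufficiently large $H$ there exists $\gamma\in \mathrm{SL}_2(\mathbb{F}_q[T])$ with $|\gamma|\le H$ and $|\gamma\underline{x}-\underline{y}|\le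 H^{-\hat\mu}$. *)

theory Defs
  imports
    "HOL-Analysis.Analysis"
    "HOL-Computational_Algebra.Formal_Laurent_Series"
begin

text \<open>
  The field of Laurent series in \<open>T\<inverse>\<close> over a finite field is the type \<open>'a fls\<close> with
  \<open>'a :: {field, finite}\<close>, where \<open>q = CARD('a)\<close>. The library's formal variable \<open>fls_X\<close> plays
  the role of \<open>T\<inverse>\<close>, so \<open>T\<close> is \<open>fls_X_inv\<close>, the coefficient of \<open>T\<^sup>n\<close> in \<open>x\<close> is \<open>fls_nth x (-n)\<close>,
  and the degree in \<open>T\<close> of a nonzero \<open>x\<close> is \<open>- fls_subdegree x\<close>.
\<close>

definition labs :: "'a::{field,finite} fls \<Rightarrow> real" where
  "labs x = (if x = 0 then 0 else real CARD('a) powi (- fls_subdegree x))"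

definition poly_T :: "'a::field poly \<Rightarrow> 'a fls" where
  "poly_T P = poly (map_poly fls_const P) fls_X_inv"

lemma poly_T_nth: "fls_nth (poly_T P) k = (if k \<le> 0 then coeff P (nat (- k)) else 0)"
proof (induction P arbitrary: k)
  case 0
  then show ?case by (simp add: poly_T_def)
next
  case (pCons a P)
  have "poly_T (pCons a P) = fls_const a + fls_X_inv * poly_T P"
    using pCons.hyps by (simp add: poly_T_def map_poly_pCons)
  then have "fls_nth (poly_T (pCons a P)) k = (if k = 0 then a else 0) + fls_nth (poly_T P) (k + 1)"
    by (simp add: fls_X_inv_times_conv_shift)
  moreover have "nat (- k) = Suc (nat (- k - 1))" if "k < 0"
    using that by simp
  ultimately show ?case
    using pCons.IH[of "k + 1"] by (auto simp: coeff_pCons split: nat.splits)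
qed

definition rational_functions :: "'a::field fls set" where
  "rational_functions = {poly_T P / poly_T Q | P Q. Q \<noteq> 0}"

definition dist_poly :: "'a::{field,finite} fls \<Rightarrow> real" where
  "dist_poly x = (INF P. labs (x - poly_T P))"

definition vec_labs :: "'a::{field,finite} fls ^ 2 \<Rightarrow> real" where
  "vec_labs v = Max {labs (v $ i) | i. True}"

definition mat_labs :: "'a::{field,finite} poly ^ 2 ^ 2 \<Rightarrow> real" where
  "mat_labs A = Max {labs (poly_T (A $ i $ j)) | i j. True}"

definition SL2 :: "('a::field poly ^ 2 ^ 2) set" where
  "SL2 = {A. det A = 1}"

definition act :: "'a::field poly ^ 2 ^ 2 \<Rightarrow> 'a fls ^ 2 \<Rightarrow> 'a fls ^ 2" where
  "act A v = map_matrix poly_T A *v v"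

definition irrationality_exponent :: "'a::{field,finite} fls \<Rightarrow> ereal" where
  "irrationality_exponent \<xi> = Sup {ereal w | w.
     \<exists>\<^sub>F H in at_top. \<exists>Q. Q \<noteq> 0 \<and> labs (poly_T Q) \<le> H \<and> dist_poly (poly_T Q * \<xi>) \<le> H powr (- w)}"

definition mu :: "'a::{field,finite} fls ^ 2 \<Rightarrow> 'a fls ^ 2 \<Rightarrow> ereal" where
  "mu x y = Sup {ereal m | m.
     infinite {A \<in> SL2. vec_labs (act A x - y) \<le> mat_labs A powr (- m)}}"

definition mu_hat :: "'a::{field,finite} fls ^ 2 \<Rightarrow> 'a fls ^ 2 \<Rightarrow> ereal" where
  "mu_hat x y = Sup {ereal m | m.
     \<forall>\<^sub>F H in at_top. \<exists>A\<in>SL2. mat_labs A \<le> H \<and> vec_labs (act A x - y) \<le> H powr (- m)}"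

text \<open>
  In \<^typ>\<open>ereal\<close> we have \<open>\<infinity> / \<infinity> = 0\<close>, so quotients whose numerator and denominator are both
  infinite at exponent \<open>\<infinity>\<close> are given their limiting value there by hand. The quotients
  \<open>1 / w\<close>, \<open>1 / (w + 1)\<close> and \<open>1 / (4 * w)\<close> already evaluate to \<open>0\<close> at \<open>w = \<infinity>\<close>.
\<close>

definition rational_slope_mu :: "ereal \<Rightarrow> ereal" where
  "rational_slope_mu w = (if w = \<infinity> then 1 else w / (w + 1))"

text \<open>
  Here \<open>w\<close> is the exponent of \<open>\<xi>\<close> and \<open>v\<close> that of the slope of the target.
\<close>

definition irrational_slope_mu_hat_bound :: "ereal \<Rightarrow> ereal \<Rightarrow> ereal" where
  "irrational_slope_mu_hat_bound w v =
     (if v = \<infinity> then 1 / (4 * w) else (v + 1) / (2 * (2 * v + 1) * w))"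

end

theory Submission
  imports Defs
begin

text \<open>
  Let \<open>v k = (Q k, R k)\<close> be the convergents of \<open>\<xi>\<close>, with signs chosen so that consecutive ones form
  a matrix of determinant 1, and let \<open>n k\<close> be the logarithm of the absolute value of \<open>Q k\<close>. The
  exponent of \<open>\<xi>\<close> is the upper limit of \<open>n (k + 1) / n k\<close>.

  Lower bounds. The matrices with rows \<open>v (k + 1)\<close>, \<open>v k\<close> approximate \<open>0\<close>. For a multiple \<open>\<theta> (p, s)\<close>
  of a primitive polynomial vector, complete \<open>(p, s)\<close> to a matrix of determinant 1 and multiply it
  with the matrix with rows \<open>t v (k + 1) - v k\<close>, \<open>v (k + 1)\<close>, where \<open>t\<close> is the polynomial part
  that brings the first coordinate closest to \<open>\<theta>\<close>. For a target \<open>y\<close> of irrational slope, \<open>(p, s)\<close>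
  runs over the convergents of that slope and \<open>\<theta> = y\<^sub>2 / s\<close>.

  Upper bounds. A row \<open>(a, b)\<close> for which \<open>a\<close> and \<open>a \<xi> + b\<close> are both small is a multiple of a
  convergent, because its determinant with that convergent is a polynomial of absolute value
  less than 1. For \<open>y = 0\<close> this would apply to both rows of the matrix; for rational slope it
  forces the second row, after moving \<open>y\<close> to the first axis, and then the determinant equation
  bounds the first row from below.
\<close>

no_notation fps_nth (infixl "$" 75)

section \<open>The absolute value\<close>

lemma card_field_ge_2: "real CARD('a::{field,finite}) \<ge> 2"
proof -
  have "card {0, 1 :: 'a} \<le> CARD('a)"
    by (rule card_mono) auto
  then show ?thesis by simp
qed

lemma labs_0 [simp]: "labs 0 = 0"
  by (simp add: labs_def)

lemma labs_1 [simp]: "labs 1 = 1"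
  by (simp add: labs_def)

lemma labs_nonneg [simp]: "labs x \<ge> 0"
  by (simp add: labs_def)

lemma labs_pos_iff [simp]: "labs x > 0 \<longleftrightarrow> x \<noteq> 0"
  for x :: "'a::{field,finite} fls"
  using card_field_ge_2[where 'a='a] by (auto simp: labs_def)

lemma labs_eq_0_iff [simp]: "labs x = 0 \<longleftrightarrow> x = 0"
  using labs_pos_iff[of x] labs_nonneg[of x] less_le by metis

lemma labs_mult: "labs (x * y) = labs x * labs y"
  for x y :: "'a::{field,finite} fls"
proof (cases "x = 0 \<or> y = 0")
  case False
  then show ?thesis
    using card_field_ge_2[where 'a='a]
    by (simp add: labs_def flip: power_int_add)
qed auto

lemma labs_divide: "labs (x / y) = labs x / labs y"
proof (cases "y = 0")
  case False
  then have "labs (x / y) * labs y = labs x"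
    by (simp flip: labs_mult)
  then show ?thesis using False by (metis labs_eq_0_iff nonzero_eq_divide_eq)
qed simp

lemma labs_minus [simp]: "labs (- x) = labs x"
  by (simp add: labs_def)

lemma labs_add_le: "labs (x + y) \<le> max (labs x) (labs y)"
  for x y :: "'a::{field,finite} fls"
proof (cases "x = 0 \<or> y = 0 \<or> x + y = 0")
  case True
  then show ?thesis by (auto simp: le_max_iff_disj)
next
  case False
  then have "min (fls_subdegree x) (fls_subdegree y) \<le> fls_subdegree (x + y)"
    by (intro fls_plus_subdegree) auto
  then have "fls_subdegree x \<le> fls_subdegree (x + y) \<or> fls_subdegree y \<le> fls_subdegree (x + y)"
    by linarith
  then show ?thesis
    using False card_field_ge_2[where 'a='a]
    by (auto simp: labs_def le_max_iff_disj intro!: power_int_increasing)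
qed

lemma labs_diff_le: "labs (x - y) \<le> max (labs x) (labs y)"
  using labs_add_le[of x "- y"] by simp

text \<open>\<open>x\<close> is the difference of \<open>x + y\<close> and \<open>y\<close>, so in
  an ultrametric a strictly smaller \<open>y\<close> cannot change the absolute value.\<close>

lemma labs_add_eq: "labs y < labs x \<Longrightarrow> labs (x + y) = labs x"
  using labs_add_le[of x y] labs_diff_le[of "x + y" y] by (simp add: max_def split: if_splits)

lemma labs_diff_eq: "labs y < labs x \<Longrightarrow> labs (x - y) = labs x"
  using labs_add_eq[of "- y" x] by simp

section \<open>Polynomials as elements of the Laurent series field\<close>

lemma poly_T_0 [simp]: "poly_T 0 = 0"
  by (simp add: poly_T_def)

lemma poly_T_1 [simp]: "poly_T 1 = 1"
  by (simp add: poly_T_def)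

lemma poly_T_add: "poly_T (P + Q) = poly_T P + poly_T Q"
  by (rule fls_eqI) (simp add: poly_T_nth)

lemma poly_T_uminus: "poly_T (- P) = - poly_T P"
  by (rule fls_eqI) (simp add: poly_T_nth)

lemma poly_T_diff: "poly_T (P - Q) = poly_T P - poly_T Q"
  by (rule fls_eqI) (simp add: poly_T_nth)

lemma poly_T_smult: "poly_T (smult a P) = fls_const a * poly_T P"
  by (rule fls_eqI) (simp add: poly_T_nth)

lemma poly_T_pCons: "poly_T (pCons a P) = fls_const a + fls_X_inv * poly_T P"
  by (cases "P = 0"; cases "a = 0") (simp_all add: poly_T_def map_poly_pCons)

lemma poly_T_mult: "poly_T (P * Q) = poly_T P * poly_T Q"
proof (induction P)
  case (pCons a P)
  then show ?case
    by (simp add: poly_T_add poly_T_smult poly_T_pCons algebra_simps)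
qed simp

lemmas poly_T_hom = poly_T_add poly_T_diff poly_T_uminus poly_T_mult

lemma poly_T_eq_0_iff [simp]: "poly_T P = 0 \<longleftrightarrow> P = 0"
proof
  assume "poly_T P = 0"
  then have "coeff P n = 0" for n
    using poly_T_nth[of P "- int n"] by simp
  then show "P = 0" by (simp add: poly_eq_iff)
qed simp

abbreviation pabs :: "'a::{field,finite} poly \<Rightarrow> real" where
  "pabs P \<equiv> labs (poly_T P)"

lemma pabs_eq_degree:
  fixes P :: "'a::{field,finite} poly"
  assumes "P \<noteq> 0"
  shows "pabs P = real CARD('a) ^ degree P"
proof -
  have "fls_subdegree (poly_T P) = - int (degree P)"
  proof (rule fls_subdegree_eqI)
    show "fls_nth (poly_T P) (- int (degree P)) \<noteq> 0"
      using assms by (simp add: poly_T_nth)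
    fix k assume "k < - int (degree P)"
    then show "fls_nth (poly_T P) k = 0"
      by (auto simp: poly_T_nth intro!: coeff_eq_0)
  qed
  then show ?thesis using assms by (simp add: labs_def)
qed

text \<open>A power of \<open>q\<close> with a nonnegative exponent. This gap below 1 is what later
  turns smallness of a polynomial into its vanishing.\<close>

lemma pabs_ge_1: "P \<noteq> 0 \<Longrightarrow> pabs P \<ge> 1"
  for P :: "'a::{field,finite} poly"
  using card_field_ge_2[where 'a='a] by (simp add: pabs_eq_degree)

lemma pabs_less_1_iff: "pabs P < 1 \<longleftrightarrow> P = 0"
  using pabs_ge_1[of P] by fastforce

text \<open>A bound on the absolute value bounds the degree, and a finite field leaves finitely many
  coefficient lists.\<close>

lemma finite_pabs_le: "finite {P :: 'a::{field,finite} poly. pabs P \<le> B}"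
proof -
  \<comment> \<open>Base 2 is enough, since \<open>q\<close> is at least 2.\<close>
  obtain n where n: "B < 2 ^ n"
    using real_arch_pow[of 2 B] by auto
  have "degree P \<le> n" if P: "pabs P \<le> B" for P :: "'a poly"
  proof (rule ccontr)
    assume "\<not> degree P \<le> n"
    then have "P \<noteq> 0" "n \<le> degree P" by auto
    have "(2::real) ^ n \<le> 2 ^ degree P"
      using \<open>n \<le> degree P\<close> by simp
    also have "\<dots> \<le> pabs P"
      using card_field_ge_2[where 'a='a] \<open>P \<noteq> 0\<close> by (simp add: pabs_eq_degree power_mono)
    finally show False using n P by simp
  qed
  then have "{P :: 'a poly. pabs P \<le> B} \<subseteq> Poly ` {xs. set xs \<subseteq> UNIV \<and> length xs \<le> Suc n}"
  proof (intro subsetI)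
    fix P :: "'a poly"
    assume *: "\<And>P :: 'a poly. pabs P \<le> B \<Longrightarrow> degree P \<le> n" and "P \<in> {P. pabs P \<le> B}"
    then have "degree P \<le> n" by simp
    then have "P = Poly (coeffs P)" "length (coeffs P) \<le> Suc n"
      by (simp, simp add: coeffs_def)
    then show "P \<in> Poly ` {xs. set xs \<subseteq> UNIV \<and> length xs \<le> Suc n}" by blast
  qed
  moreover have "finite {xs. set xs \<subseteq> (UNIV :: 'a set) \<and> length xs \<le> Suc n}"
    by (rule finite_lists_length_le) simp
  ultimately show ?thesis
    by (meson finite_imageI finite_subset)
qed

text \<open>Keeping only the nonnegative powers of \<open>T\<close> leaves a polynomial; what is
  dropped has subdegree at least 1.\<close>

lemma polynomial_part_exists:
  fixes z :: "'a::{field,finite} fls"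
  shows "\<exists>P. labs (z - poly_T P) < 1"
proof -
  define c where "c = (\<lambda>n. fls_nth z (- int n))"
  have "\<forall>n>nat (- fls_subdegree z). c n = 0"
    by (auto simp: c_def)
  then have "coeff (Abs_poly c) = c"
    by (intro coeff_Abs_poly) auto
  then have *: "fls_nth (z - poly_T (Abs_poly c)) k = 0" if "k < 1" for k
    using that by (simp add: poly_T_nth c_def)
  show ?thesis
  proof (cases "z - poly_T (Abs_poly c) = 0")
    case False
    then have "fls_subdegree (z - poly_T (Abs_poly c)) \<ge> 1"
      using * by (intro fls_subdegree_geI) auto
    then have "real CARD('a) powi (- fls_subdegree (z - poly_T (Abs_poly c))) < real CARD('a) powi 0"
      using card_field_ge_2[where 'a='a] by (intro power_int_strict_increasing) auto
    then have "labs (z - poly_T (Abs_poly c)) < 1"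
      using False by (simp add: labs_def)
    then show ?thesis by blast
  qed (metis labs_0 zero_less_one)
qed

lemma dist_poly_le: "dist_poly z \<le> labs (z - poly_T P)"
  unfolding dist_poly_def by (rule cINF_lower) (auto intro!: bdd_belowI[of _ 0])

lemma dist_poly_ge: "(\<And>P. B \<le> labs (z - poly_T P)) \<Longrightarrow> B \<le> dist_poly z"
  unfolding dist_poly_def by (rule cINF_greatest) auto

lemma linear_form_nonzero:
  assumes "\<xi> \<notin> rational_functions" and "a \<noteq> 0 \<or> b \<noteq> 0"
  shows "poly_T a * \<xi> + poly_T b \<noteq> 0"
proof
  assume *: "poly_T a * \<xi> + poly_T b = 0"
  then have "a \<noteq> 0" using assms(2) by auto
  then have "\<xi> = poly_T (- b) / poly_T a"
    using * by (simp add: poly_T_uminus field_simps eq_neg_iff_add_eq_0)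
  then show False
    using assms(1) \<open>a \<noteq> 0\<close> unfolding rational_functions_def by blast
qed

section \<open>Norms of vectors and matrices\<close>

lemma exists_2: "(\<exists>i::2. P i) \<longleftrightarrow> P 1 \<or> P 2"
  using exhaust_2 by metis

lemma vec_labs_le_iff: "vec_labs v \<le> B \<longleftrightarrow> labs (v $ 1) \<le> B \<and> labs (v $ 2) \<le> B"
proof -
  have "{labs (v $ i) | i. True} = {labs (v $ 1), labs (v $ 2)}"
    by (auto simp: exists_2)
  then show ?thesis by (simp add: vec_labs_def)
qed

lemma vec_labs_nonneg: "0 \<le> vec_labs v"
  using vec_labs_le_iff[of v "vec_labs v"] labs_nonneg[of "v $ 1"] by linarith

lemma vec_labs_pos_iff: "0 < vec_labs v \<longleftrightarrow> v \<noteq> 0"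
proof -
  have "vec_labs v \<le> 0 \<longleftrightarrow> v = 0"
    by (auto simp: vec_labs_le_iff vec_eq_iff forall_2 order_antisym_conv[of _ "0::real"]
        antisym_conv simp flip: labs_eq_0_iff)
  then show ?thesis by linarith
qed

lemma mat_labs_le_iff:
  "mat_labs A \<le> B \<longleftrightarrow> pabs (A $ 1 $ 1) \<le> B \<and> pabs (A $ 1 $ 2) \<le> B
     \<and> pabs (A $ 2 $ 1) \<le> B \<and> pabs (A $ 2 $ 2) \<le> B"
proof -
  have "{pabs (A $ i $ j) | i j. True}
      = {pabs (A $ 1 $ 1), pabs (A $ 1 $ 2), pabs (A $ 2 $ 1), pabs (A $ 2 $ 2)}"
    by (auto simp: exists_2)
  then show ?thesis by (simp add: mat_labs_def)
qed

lemma act_nth: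
  "act A x $ i = poly_T (A $ i $ 1) * x $ 1 + poly_T (A $ i $ 2) * x $ 2"
  by (simp add: act_def matrix_vector_mult_def map_matrix_def sum_2)

lemma SL2_iff: "A \<in> SL2 \<longleftrightarrow> A $ 1 $ 1 * A $ 2 $ 2 - A $ 1 $ 2 * A $ 2 $ 1 = 1"
  by (simp add: SL2_def det_2)

text \<open>An entry of absolute value below 1 is zero, so a smaller norm would leave only the zero
  matrix.\<close>

lemma SL2_mat_labs_ge_1:
  assumes "A \<in> SL2"
  shows "mat_labs A \<ge> 1"
proof (rule ccontr)
  assume "\<not> mat_labs A \<ge> 1"
  then have "pabs (A $ i $ j) < 1" for i j
    using mat_labs_le_iff[of A "mat_labs A"] exhaust_2[of i] exhaust_2[of j] by fastforce
  then have "A $ i $ j = 0" for i j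
    by (simp add: pabs_less_1_iff)
  then show False
    using assms by (simp add: SL2_iff)
qed

lemma finite_mat_labs_le:
  "finite {A :: 'a::{field,finite} poly ^ 2 ^ 2. mat_labs A \<le> B}"
proof -
  let ?S = "{P :: 'a poly. pabs P \<le> B}"
  let ?m = "\<lambda>(a, b, c, d). vector [vector [a, b], vector [c, d]] :: 'a poly ^ 2 ^ 2"
  have "{A. mat_labs A \<le> B} \<subseteq> ?m ` (?S \<times> ?S \<times> ?S \<times> ?S)"
  proof
    fix A :: "'a poly ^ 2 ^ 2"
    assume "A \<in> {A. mat_labs A \<le> B}"
    then have "(A $ 1 $ 1, A $ 1 $ 2, A $ 2 $ 1, A $ 2 $ 2) \<in> ?S \<times> ?S \<times> ?S \<times> ?S"
      by (simp add: mat_labs_le_iff)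
    moreover have "A = ?m (A $ 1 $ 1, A $ 1 $ 2, A $ 2 $ 1, A $ 2 $ 2)"
      by (simp add: vec_eq_iff forall_2)
    ultimately show "A \<in> ?m ` (?S \<times> ?S \<times> ?S \<times> ?S)" by (rule rev_image_eqI)
  qed
  then show ?thesis
    by (rule finite_subset) (intro finite_imageI finite_cartesian_product finite_pabs_le)
qed

section \<open>Criteria for the exponents\<close>

text \<open>Without a crossing, induction would keep \<open>f\<close> below \<open>h\<close>
  forever. Used to place a height between two consecutive denominators.\<close>

lemma filterlim_at_top_crossing:
  fixes f :: "nat \<Rightarrow> real"
  assumes "filterlim f at_top sequentially" and "f K \<le> h"
  shows "\<exists>k\<ge>K. f k \<le> h \<and> h < f (Suc k)"
proof (rule ccontr)
  assume *: "\<not> ?thesis"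
  have "f k \<le> h" if "k \<ge> K" for k
    using that by (induction k rule: dec_induct) (use assms(2) * in force)+
  moreover have "eventually (\<lambda>k. f k > h \<and> k \<ge> K) sequentially"
    using assms(1) by (intro eventually_conj eventually_ge_at_top) (simp add: filterlim_at_top_dense)
  then obtain k where "f k > h" "k \<ge> K"
    by (auto simp: eventually_sequentially)
  ultimately show False by force
qed

text \<open>Absorbs additive constants: a gap between the slopes pays for any \<open>c\<close> once
  \<open>f\<close> is large.\<close>

lemma eventually_linear_le:
  fixes f :: "'b \<Rightarrow> real"
  assumes "filterlim f at_top F" and "a < b"
  shows "eventually (\<lambda>k. a * f k + c \<le> b * f k) F"
proof -
  have "eventually (\<lambda>k. f k \<ge> c / (b - a)) F"
    using assms(1) by (simp add: filterlim_at_top)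
  then show ?thesis
    by eventually_elim (use assms(2) in \<open>simp add: field_simps\<close>)
qed

lemma powr_minus_eq_exp: "B > 0 \<Longrightarrow> B powr (- m) = exp (- (m * ln B))" for B :: real
  by (simp add: powr_def)

text \<open>Heights and errors are measured by their logarithms \<open>f\<close> and
  \<open>g\<close>. Finitely many solutions would leave a positive minimum among the nonzero errors,
  which a larger \<open>G\<close> undercuts; \<open>act A x \<noteq> y\<close> keeps the new error
  nonzero.\<close>

lemma le_mu:
  fixes x y :: "'a::{field,finite} fls ^ 2"
  assumes "m > 0"
    and approx: "\<And>G. \<exists>A\<in>SL2. \<exists>f g. g \<ge> G \<and> m * f \<le> g \<and> act A x \<noteq> y
      \<and> mat_labs A \<le> exp f \<and> vec_labs (act A x - y) \<le> exp (- g)"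
  shows "ereal m \<le> mu x y"
proof -
  let ?S = "{A \<in> SL2. vec_labs (act A x - y) \<le> mat_labs A powr (- m)}"
  have "infinite ?S"
  proof
    assume fin: "finite ?S"
    \<comment> \<open>The element 1 keeps \<open>Min V\<close> meaningful when there is no solution
      with nonzero error.\<close>
    define V where "V = insert 1 ((\<lambda>A. vec_labs (act A x - y)) ` {A \<in> ?S. act A x \<noteq> y})"
    have "finite {A \<in> ?S. act A x \<noteq> y}" by (rule finite_subset[OF _ fin]) auto
    then have "finite V" unfolding V_def by blast
    then have V: "Min V > 0" "\<And>v. v \<in> V \<Longrightarrow> Min V \<le> v"
      by (auto simp: V_def vec_labs_pos_iff)
    \<comment> \<open>The lower bound on \<open>g\<close> makes the new error smaller than
      \<open>Min V\<close>.\<close>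
    obtain A f g where A: "A \<in> SL2" "g \<ge> 1 - ln (Min V)" "m * f \<le> g" "act A x \<noteq> y"
      "mat_labs A \<le> exp f" "vec_labs (act A x - y) \<le> exp (- g)"
      using approx by blast
    have "mat_labs A \<ge> 1" using SL2_mat_labs_ge_1 A(1) .
    have "exp (- g) \<le> exp f powr (- m)"
      using A(3) by (simp add: powr_minus_eq_exp)
    also have "\<dots> \<le> mat_labs A powr (- m)"
      using A(5) \<open>mat_labs A \<ge> 1\<close> \<open>m > 0\<close> by (intro powr_mono2') auto
    finally have "A \<in> ?S" using A(1,6) by simp
    then have "Min V \<le> vec_labs (act A x - y)"
      using A(4) by (intro V) (simp add: V_def)
    also have "\<dots> \<le> exp (- g)" by fact
    also have "\<dots> < exp (ln (Min V))" using A(2) by (subst exp_less_cancel_iff) linarith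
    also have "\<dots> = Min V" using V by simp
    finally show False by simp
  qed
  then show ?thesis unfolding mu_def by (intro Sup_upper) blast
qed

text \<open>Only finitely many matrices have norm at most \<open>G\<close>, so a norm bound for all
  solutions rules out infinitely many.\<close>

lemma mu_le:
  fixes x y :: "'a::{field,finite} fls ^ 2"
  assumes "\<And>m. B < ereal m \<Longrightarrow> \<exists>G. \<forall>A\<in>SL2.
      vec_labs (act A x - y) \<le> mat_labs A powr (- m) \<longrightarrow> mat_labs A \<le> G"
  shows "mu x y \<le> B"
  unfolding mu_def
proof (rule Sup_least, clarify)
  fix m
  assume inf: "infinite {A \<in> SL2. vec_labs (act A x - y) \<le> mat_labs A powr (- m)}"
  show "ereal m \<le> B"
  proof (rule ccontr)
    assume "\<not> ereal m \<le> B"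
    then have "B < ereal m" by simp
    then obtain G where "\<forall>A\<in>SL2. vec_labs (act A x - y) \<le> mat_labs A powr (- m) \<longrightarrow> mat_labs A \<le> G"
      using assms[of m] by blast
    then have "{A \<in> SL2. vec_labs (act A x - y) \<le> mat_labs A powr (- m)} \<subseteq> {A. mat_labs A \<le> G}"
      by auto
    then show False using inf finite_mat_labs_le finite_subset by blast
  qed
qed

text \<open>The matrix of index \<open>k\<close> has to serve every height until the next matrix
  becomes available, which is why its error is compared with \<open>f (Suc k)\<close>.\<close>

lemma le_mu_hat:
  fixes x y :: "'a::{field,finite} fls ^ 2"
  assumes "m > 0"
    and f: "filterlim f at_top sequentially"
    and approx: "eventually (\<lambda>k. \<exists>A\<in>SL2. mat_labs A \<le> exp (f k)
      \<and> vec_labs (act A x - y) \<le> exp (- g k)) sequentially"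
    and fg: "eventually (\<lambda>k. m * f (Suc k) \<le> g k) sequentially"
  shows "ereal m \<le> mu_hat x y"
proof -
  obtain K where K: "\<And>k. k \<ge> K \<Longrightarrow> \<exists>A\<in>SL2. mat_labs A \<le> exp (f k)
      \<and> vec_labs (act A x - y) \<le> exp (- g k)" "\<And>k. k \<ge> K \<Longrightarrow> m * f (Suc k) \<le> g k"
    using eventually_conj[OF approx fg] by (auto simp: eventually_sequentially)
  have "\<forall>\<^sub>F H in at_top. \<exists>A\<in>SL2. mat_labs A \<le> H \<and> vec_labs (act A x - y) \<le> H powr (- m)"
    using eventually_ge_at_top[of "exp (f K)"]
  proof eventually_elim
    case (elim H)
    have "H > 0" using elim exp_gt_zero[of "f K"] by linarith
    have "f K \<le> ln H" using elim \<open>H > 0\<close> by (simp add: ln_ge_iff)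
    then obtain k where k: "k \<ge> K" "f k \<le> ln H" "ln H < f (Suc k)"
      using filterlim_at_top_crossing[OF f] by blast
    obtain A where A: "A \<in> SL2" "mat_labs A \<le> exp (f k)" "vec_labs (act A x - y) \<le> exp (- g k)"
      using K(1)[OF k(1)] by blast
    have "exp (f k) \<le> H" using k(2) \<open>H > 0\<close> by (simp add: ln_ge_iff)
    moreover have "m * ln H \<le> m * f (Suc k)" using k(3) \<open>m > 0\<close> by simp
    then have "exp (- g k) \<le> H powr (- m)"
      using K(2)[OF k(1)] \<open>H > 0\<close> by (simp add: powr_minus_eq_exp)
    ultimately show ?case using A by (intro bexI[of _ A]) auto
  qed
  then show ?thesis unfolding mu_hat_def by (intro Sup_upper) blast
qed

lemma mu_hat_le:
  fixes x y :: "'a::{field,finite} fls ^ 2"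
  assumes "\<And>m. B < ereal m \<Longrightarrow> \<exists>\<^sub>F H in at_top.
      \<not> (\<exists>A\<in>SL2. mat_labs A \<le> H \<and> vec_labs (act A x - y) \<le> H powr (- m))"
  shows "mu_hat x y \<le> B"
  unfolding mu_hat_def
proof (rule Sup_least, clarify)
  fix m
  assume ev: "\<forall>\<^sub>F H in at_top. \<exists>A\<in>SL2. mat_labs A \<le> H \<and> vec_labs (act A x - y) \<le> H powr (- m)"
  show "ereal m \<le> B"
  proof (rule ccontr)
    assume "\<not> ereal m \<le> B"
    then have "B < ereal m" by simp
    then show False
      using assms[of m] ev by (simp add: frequently_def)
  qed
qed

text \<open>Reduces a lower bound that may be infinite to positive real exponents strictly below
  it.\<close>

lemma le_ereal_positive_dense:
  fixes B S :: ereal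
  assumes "0 \<le> S" and "\<And>m. m > 0 \<Longrightarrow> ereal m < B \<Longrightarrow> ereal m \<le> S"
  shows "B \<le> S"
proof (rule dense_le)
  fix z assume "z < B"
  show "z \<le> S"
  proof (cases "z > 0")
    case True
    then obtain m where "z = ereal m" using \<open>z < B\<close> by (cases z) auto
    then show ?thesis using True assms(2) \<open>z < B\<close> by auto
  next
    case False
    then show ?thesis using assms(1) by auto
  qed
qed

text \<open>The identity matrix has a fixed error, which a positive power of the height eventually
  exceeds.\<close>

lemma mu_hat_nonneg:
  fixes x y :: "'a::{field,finite} fls ^ 2"
  shows "0 \<le> mu_hat x y"
proof (rule dense_le)
  fix z :: ereal assume "z < 0"
  then obtain m where m: "z < ereal m" "ereal m < 0"
    using ereal_dense2 by blast
  define V where "V = vec_labs (act (mat 1) x - y)"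
  \<comment> \<open>The threshold raised to the power \<open>- m\<close> is
    \<open>V + 1\<close>.\<close>
  have "\<forall>\<^sub>F H in at_top. (V + 1) powr (1 / (- m)) \<le> H"
    by (rule eventually_ge_at_top)
  then have "\<forall>\<^sub>F H in at_top. V \<le> H powr (- m)"
  proof eventually_elim
    case (elim H)
    have "V \<ge> 0" by (simp add: V_def vec_labs_nonneg)
    then have "V \<le> ((V + 1) powr (1 / (- m))) powr (- m)"
      using m by (simp add: powr_powr)
    also have "\<dots> \<le> H powr (- m)"
      using elim m by (intro powr_mono2) auto
    finally show ?case .
  qed
  moreover have "\<forall>\<^sub>F H in at_top. (mat_labs (mat 1 :: 'a poly ^ 2 ^ 2)) \<le> H"
    by (rule eventually_ge_at_top)
  ultimately have "\<forall>\<^sub>F H in at_top. \<exists>A\<in>SL2. mat_labs A \<le> H \<and> vec_labs (act A x - y) \<le> H powr (- m)"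
    by eventually_elim (rule bexI[of _ "mat 1"], auto simp: SL2_def V_def)
  then have "ereal m \<le> mu_hat x y"
    unfolding mu_hat_def by (intro Sup_upper) blast
  then show "z \<le> mu_hat x y" using m by auto
qed

section \<open>Convergents\<close>

text \<open>The k-th convergent is the quotient of \<open>- R k\<close> by \<open>Q k\<close>. The
  determinant stays 1 instead of alternating in sign, and the remainder is an equality because the
  absolute value is ultrametric.\<close>

locale convergents =
  fixes \<xi> :: "'a::{field,finite} fls" and Q R :: "nat \<Rightarrow> 'a poly"
  assumes irrational: "\<xi> \<notin> rational_functions"
    and det: "Q (Suc k) * R k - R (Suc k) * Q k = 1"
    and Q_0: "pabs (Q 0) = 1"
    and Q_less: "pabs (Q k) < pabs (Q (Suc k))"
    and remainder: "labs (poly_T (Q k) * \<xi> + poly_T (R k)) = 1 / pabs (Q (Suc k))"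

text \<open>Continued fraction expansion: each new pair is a partial quotient times the current pair
  minus the previous one. The minus sign preserves the determinant.\<close>

lemma convergents_exist:
  fixes \<xi> :: "'a::{field,finite} fls"
  assumes irr: "\<xi> \<notin> rational_functions"
  shows "\<exists>Q R. convergents \<xi> Q R"
proof -
  define e where "e Q R = poly_T Q * \<xi> + poly_T R" for Q R
  \<comment> \<open>A state holds the current pair followed by the previous one.\<close>
  define inv where "inv = (\<lambda>(Q, R, Q', R'). Q * R' - R * Q' = 1 \<and> pabs Q' < pabs Q
     \<and> labs (e Q' R') = 1 / pabs Q \<and> labs (e Q R) < labs (e Q' R'))"
  define next_conv where "next_conv = 
    (\<lambda>(Q, R, Q' :: 'a poly, R' :: 'a poly) (Q2 :: 'a poly, R2 :: 'a poly, Q1 :: 'a poly, R1 :: 'a poly).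
      Q1 = Q \<and> R1 = R)"
  obtain P where P: "labs (\<xi> - poly_T P) < 1"
    using polynomial_part_exists by blast
  \<comment> \<open>The previous pair \<open>(0, 1)\<close> has linear form 1, which is the inverse
    of the current denominator 1.\<close>
  have start: "inv (1, - P, 0, 1)"
    using P by (simp add: inv_def e_def poly_T_uminus)
  have step: "\<exists>t. inv t \<and> next_conv s t" if inv: "inv s" for s
  proof -
    obtain Q R Q' R' where s: "s = (Q, R, Q', R')" by (cases s) auto
    have d: "Q * R' - R * Q' = 1" and lt: "pabs Q' < pabs Q"
      and r': "labs (e Q' R') = 1 / pabs Q" and rlt: "labs (e Q R) < labs (e Q' R')"
      using inv by (auto simp: s inv_def)
    have Q: "pabs Q > 0" "Q \<noteq> 0"
      using lt labs_nonneg[of "poly_T Q'"] by (metis labs_pos_iff poly_T_eq_0_iff order_le_less_trans)+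
    have e0: "e Q R \<noteq> 0"
      unfolding e_def using linear_form_nonzero[OF irr] Q by blast
    then have e_pos: "labs (e Q R) > 0" by simp
    \<comment> \<open>The next partial quotient: the polynomial part of the previous linear form
      divided by the current one.\<close>
    obtain a where a: "labs (e Q' R' / e Q R - poly_T a) < 1"
      using polynomial_part_exists by blast
    have gt1: "labs (e Q' R' / e Q R) > 1"
      using rlt e_pos by (simp add: labs_divide)
    have a_abs: "pabs a = labs (e Q' R' / e Q R)"
      using labs_diff_eq[of "e Q' R' / e Q R - poly_T a" "e Q' R' / e Q R"] a gt1 by simp
    let ?Q = "a * Q - Q'" and ?R = "a * R - R'"
    have e2: "e ?Q ?R = poly_T a * e Q R - e Q' R'"
      by (simp add: e_def poly_T_hom algebra_simps)
    also have "\<dots> = - (e Q' R' / e Q R - poly_T a) * e Q R"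
      using e0 by (simp add: field_simps)
    finally have "labs (e ?Q ?R) = labs (e Q' R' / e Q R - poly_T a) * labs (e Q R)"
      by (simp only: labs_mult labs_minus)
    then have e2_lt: "labs (e ?Q ?R) < labs (e Q R)"
      using a e_pos by simp
    have "pabs Q < pabs a * pabs Q"
      using gt1 a_abs Q by simp
    then have Q2: "pabs ?Q = pabs a * pabs Q"
      using lt labs_diff_eq[of "poly_T Q'" "poly_T a * poly_T Q"]
      by (simp add: poly_T_hom labs_mult)
    have d2: "?Q * R - ?R * Q = 1" using d by (simp add: algebra_simps)
    have "labs (e ?Q ?R) * pabs Q < labs (e Q' R') * pabs Q"
      using e2_lt rlt Q by simp
    then have "labs (poly_T Q * e ?Q ?R) < 1"
      using r' Q by (simp add: labs_mult mult.commute)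
    \<comment> \<open>The determinant expressed through linear forms. The last product is below 1,
      so the left side has absolute value exactly 1, and this fixes the remainder of the current
      pair.\<close>
    moreover have "poly_T ?Q * e Q R = 1 + poly_T Q * e ?Q ?R"
    proof -
      have "poly_T ?Q * e Q R - poly_T Q * e ?Q ?R = poly_T (?Q * R - ?R * Q)"
        by (simp add: e_def poly_T_hom algebra_simps)
      then show ?thesis unfolding d2 by (simp add: algebra_simps)
    qed
    ultimately have "labs (poly_T ?Q * e Q R) = 1"
      using labs_add_eq[of "poly_T Q * e ?Q ?R" 1] by simp
    then have r2: "labs (e Q R) = 1 / pabs ?Q"
      by (simp add: labs_mult) (metis nonzero_eq_divide_eq mult.commute mult_zero_left zero_neq_one)
    have "inv (?Q, ?R, Q, R) \<and> next_conv s (?Q, ?R, Q, R)"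
      unfolding inv_def next_conv_def s using d2 r2 e2_lt Q2 \<open>pabs Q < pabs a * pabs Q\<close> by simp
    then show ?thesis by blast
  qed
  \<comment> \<open>The condition at \<open>k = 0\<close> pins the chain of states to the initial
    one.\<close>
  obtain f where f0: "f 0 = (1, - P, 0, 1)" and f: "\<And>k. inv (f k) \<and> next_conv (f k) (f (Suc k))"
    using dependent_nat_choice[of "\<lambda>k s. inv s \<and> (k = 0 \<longrightarrow> s = (1, - P, 0, 1))" "\<lambda>k. next_conv"]
      start step by (metis Zero_not_Suc)
  define Q where "Q k = fst (f k)" for k
  define R where "R k = fst (snd (f k))" for k
  have f_Suc: "f (Suc k) = (Q (Suc k), R (Suc k), Q k, R k)" for k
    using f[of k] by (auto simp: next_conv_def Q_def R_def split: prod.splits)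
  \<comment> \<open>The state at \<open>Suc k\<close> contains the pairs of index
    \<open>Suc k\<close> and \<open>k\<close>, so its invariant supplies determinant, growth and
    remainder at \<open>k\<close>.\<close>
  have "convergents \<xi> Q R"
  proof
    show "pabs (Q 0) = 1" by (simp add: Q_def f0)
  qed (use irr f[of "Suc _"] in \<open>auto simp: f_Suc inv_def e_def\<close>)
  then show ?thesis by blast
qed

context convergents
begin

abbreviation N :: "nat \<Rightarrow> real" where "N k \<equiv> pabs (Q k)"

abbreviation n :: "nat \<Rightarrow> real" where "n k \<equiv> ln (N k)"

definition eps :: "nat \<Rightarrow> 'a fls" where "eps k = poly_T (Q k) * \<xi> + poly_T (R k)"

lemma labs_eps: "labs (eps k) = 1 / N (Suc k)"
  by (simp add: eps_def remainder)

lemma Q_nonzero: "Q k \<noteq> 0"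
proof (cases k)
  case 0
  then show ?thesis using Q_0 by auto
next
  case (Suc j)
  then show ?thesis using Q_less[of j] labs_nonneg[of "poly_T (Q j)"] by (auto simp del: labs_nonneg)
qed

lemma N_ge_1: "N k \<ge> 1"
  by (rule pabs_ge_1) (rule Q_nonzero)

lemma N_pos: "N k > 0"
  using N_ge_1[of k] by linarith

lemma n_nonneg: "n k \<ge> 0"
  using N_ge_1[of k] by simp

lemma exp_n: "exp (n k) = N k"
  using N_pos[of k] by (rule exp_ln)

lemma eps_nonzero: "eps k \<noteq> 0"
  using labs_eps[of k] N_pos[of "Suc k"] by auto

lemma n_less: "n k < n (Suc k)"
  using Q_less N_pos by (subst ln_less_cancel_iff)

lemma n_mono: "j \<le> k \<Longrightarrow> n j \<le> n k"
  using lift_Suc_mono_le[of n] n_less less_imp_le by blast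

text \<open>Degrees of the denominators increase strictly, so \<open>n k\<close> is at least
  \<open>k * ln 2\<close>.\<close>

lemma n_at_top: "filterlim n at_top sequentially"
proof -
  have "degree (Q k) < degree (Q (Suc k))" for k
    using Q_less[of k] card_field_ge_2[where 'a='a]
    by (simp add: pabs_eq_degree Q_nonzero)
  then have deg: "k \<le> degree (Q k)" for k
    by (induction k) (auto simp: Suc_le_eq intro: le_less_trans)
  have "real k * ln 2 \<le> n k" for k
  proof -
    have "(2::real) ^ k \<le> 2 ^ degree (Q k)" using deg by simp
    also have "\<dots> \<le> N k"
      using card_field_ge_2[where 'a='a] by (simp add: pabs_eq_degree Q_nonzero power_mono)
    finally have "ln (2 ^ k) \<le> n k" using N_pos by (subst ln_le_cancel_iff) auto
    then show ?thesis by (simp add: ln_realpow)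
  qed
  moreover have "filterlim (\<lambda>k. real k * ln 2) at_top sequentially"
    by (rule filterlim_at_top_mult_tendsto_pos[OF tendsto_const _ filterlim_real_sequentially]) simp
  ultimately show ?thesis
    by (rule filterlim_at_top_mono[rotated, OF always_eventually, rule_format])
qed

lemma n_Suc_at_top: "filterlim (\<lambda>k. n (k + i)) at_top sequentially"
  using n_at_top filterlim_add_const_nat_at_top[of i]
  by (rule filterlim_compose)

text \<open>The determinant of \<open>(a, b)\<close> with the convergent is a combination of the two
  small products, hence a polynomial below 1, hence zero. Since consecutive convergents are
  unimodular, the factor of proportionality is a polynomial.\<close>

lemma proportional_to_convergent:
  assumes "labs (poly_T a * eps k) < 1" and "labs (poly_T (Q k) * (poly_T a * \<xi> + poly_T b)) < 1"
  shows "\<exists>c. a = c * Q k \<and> b = c * R k"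
proof -
  have "poly_T (a * R k - b * Q k)
      = poly_T a * eps k - poly_T (Q k) * (poly_T a * \<xi> + poly_T b)"
    by (simp add: eps_def poly_T_hom algebra_simps)
  then have "pabs (a * R k - b * Q k) < 1"
    using labs_diff_le[of "poly_T a * eps k" "poly_T (Q k) * (poly_T a * \<xi> + poly_T b)"] assms
    by simp
  then have eq: "a * R k = b * Q k"
    by (simp add: pabs_less_1_iff)
  \<comment> \<open>If \<open>(a, b)\<close> is a multiple of the convergent, its determinant with
    the next convergent is the multiplier.\<close>
  define c where "c = Q (Suc k) * b - R (Suc k) * a"
  have "c * Q k = Q (Suc k) * (b * Q k) - R (Suc k) * Q k * a"
    by (simp add: c_def algebra_simps)
  also have "\<dots> = (Q (Suc k) * R k - R (Suc k) * Q k) * a"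
    unfolding eq[symmetric] by (simp add: algebra_simps)
  finally have 1: "c * Q k = a" using det by simp
  have "c * R k = Q (Suc k) * R k * b - R (Suc k) * (a * R k)"
    by (simp add: c_def algebra_simps)
  also have "\<dots> = (Q (Suc k) * R k - R (Suc k) * Q k) * b"
    unfolding eq by (simp add: algebra_simps)
  finally have "c * R k = b" using det by simp
  then show ?thesis using 1 by blast
qed

text \<open>A smaller linear form would make \<open>(a, b)\<close> a nonzero polynomial multiple of
  the convergent \<open>k\<close>, whose own form already has absolute value
  \<open>1 / N (Suc k)\<close>.\<close>

lemma best_approximation:
  assumes "a \<noteq> 0" and "pabs a < N (Suc k)"
  shows "1 / N (Suc k) \<le> labs (poly_T a * \<xi> + poly_T b)"
proof (rule ccontr)
  assume *: "\<not> ?thesis"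
  have "labs (poly_T a * eps k) < 1"
    using assms(2) N_pos[of "Suc k"] by (simp add: labs_mult labs_eps)
  moreover have "N k * labs (poly_T a * \<xi> + poly_T b) < N (Suc k) * (1 / N (Suc k))"
    using * Q_less[of k] N_pos by (intro mult_strict_mono) auto
  then have "labs (poly_T (Q k) * (poly_T a * \<xi> + poly_T b)) < 1"
    using N_pos[of "Suc k"] by (simp add: labs_mult)
  ultimately obtain c where c: "a = c * Q k" "b = c * R k"
    using proportional_to_convergent by blast
  then have "poly_T a * \<xi> + poly_T b = poly_T c * eps k"
    by (simp add: eps_def poly_T_hom algebra_simps)
  then have "labs (poly_T a * \<xi> + poly_T b) = pabs c / N (Suc k)"
    by (simp add: labs_mult labs_eps)
  moreover have "pabs c \<ge> 1" using c(1) assms(1) by (intro pabs_ge_1) auto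
  ultimately show False using * N_pos[of "Suc k"] by (simp add: divide_right_mono)
qed

lemma dist_poly_Q_le: "dist_poly (poly_T (Q k) * \<xi>) \<le> exp (- n (Suc k))"
proof -
  have "dist_poly (poly_T (Q k) * \<xi>) \<le> labs (poly_T (Q k) * \<xi> - poly_T (- R k))"
    by (rule dist_poly_le)
  also have "\<dots> = labs (eps k)" by (simp add: eps_def poly_T_uminus)
  finally show ?thesis by (simp add: labs_eps exp_minus exp_n inverse_eq_divide)
qed

text \<open>The exponent is tested at the heights \<open>N k\<close> with \<open>Q k\<close> itself.
  Together with the converse \<open>frequently_n_Suc_ge\<close> this makes it the upper limit of
  \<open>n (Suc k) / n k\<close>.\<close>

lemma frequently_le_irrationality_exponent:
  assumes "\<exists>\<^sub>F k in sequentially. w * n k \<le> n (Suc k)"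
  shows "ereal w \<le> irrationality_exponent \<xi>"
proof -
  have "\<exists>\<^sub>F H in at_top. \<exists>Q. Q \<noteq> 0 \<and> pabs Q \<le> H \<and> dist_poly (poly_T Q * \<xi>) \<le> H powr (- w)"
    unfolding frequently_def
  proof
    assume "\<forall>\<^sub>F H in at_top. \<not> (\<exists>Q. Q \<noteq> 0 \<and> pabs Q \<le> H \<and> dist_poly (poly_T Q * \<xi>) \<le> H powr (- w))"
    moreover have "filterlim N at_top sequentially"
      using filterlim_compose[OF exp_at_top n_at_top] by (simp add: exp_n)
    ultimately have "\<forall>\<^sub>F k in sequentially.
        \<not> (\<exists>Q. Q \<noteq> 0 \<and> pabs Q \<le> N k \<and> dist_poly (poly_T Q * \<xi>) \<le> N k powr (- w))"
      by (rule eventually_compose_filterlim)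
    from frequently_eventually_conj[OF assms this] obtain k where k: "w * n k \<le> n (Suc k)"
        "\<not> (\<exists>Q. Q \<noteq> 0 \<and> pabs Q \<le> N k \<and> dist_poly (poly_T Q * \<xi>) \<le> N k powr (- w))"
      by (auto dest: frequently_ex)
    have "exp (- n (Suc k)) \<le> N k powr (- w)"
      using k(1) N_pos[of k] by (simp add: powr_minus_eq_exp)
    then show False
      using k(2) Q_nonzero[of k] dist_poly_Q_le[of k] by force
  qed
  then show ?thesis
    unfolding irrationality_exponent_def by (intro Sup_upper) blast
qed

lemma irrationality_exponent_ge_1: "1 \<le> irrationality_exponent \<xi>"
proof -
  have "\<exists>\<^sub>F k in sequentially. 1 * n k \<le> n (Suc k)"
    using n_less less_imp_le by (intro eventually_frequently always_eventually) auto
  then show ?thesis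
    using frequently_le_irrationality_exponent by (simp add: one_ereal_def)
qed

lemma eventually_n_Suc_le:
  assumes "irrationality_exponent \<xi> < ereal w"
  shows "\<forall>\<^sub>F k in sequentially. n (Suc k) \<le> w * n k"
proof (rule ccontr)
  assume "\<not> ?thesis"
  then have "\<exists>\<^sub>F k in sequentially. \<not> n (Suc k) \<le> w * n k"
    by (simp add: frequently_def)
  then have "\<exists>\<^sub>F k in sequentially. w * n k \<le> n (Suc k)"
    by (rule frequently_elim1) simp
  then show False
    using frequently_le_irrationality_exponent assms by force
qed

text \<open>Translates a small form into an index, so that the growth of \<open>n\<close> can be
  applied to it: \<open>k\<close> is the index with \<open>pabs a\<close> between \<open>N k\<close>
  and \<open>N (Suc k)\<close>. A form below \<open>1 / N (Suc K)\<close> forces a large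
  \<open>a\<close> by best approximation, hence \<open>k \<ge> K\<close>.\<close>

lemma linear_form_small:
  "\<exists>e>0. \<forall>a b. a \<noteq> 0 \<longrightarrow> labs (poly_T a * \<xi> + poly_T b) < e \<longrightarrow>
     (\<exists>k\<ge>K. n k \<le> ln (pabs a) \<and> - ln (labs (poly_T a * \<xi> + poly_T b)) \<le> n (Suc k))"
proof (intro exI[of _ "1 / N (Suc K)"] conjI allI impI)
  show "1 / N (Suc K) > 0" using N_pos[of "Suc K"] by simp
  fix a b
  assume a: "a \<noteq> 0" and small: "labs (poly_T a * \<xi> + poly_T b) < 1 / N (Suc K)"
  have a1: "pabs a \<ge> 1" using a by (rule pabs_ge_1)
  have "N (Suc K) \<le> pabs a"
    using best_approximation[OF a, of K b] small by force
  then have "n (Suc K) \<le> ln (pabs a)"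
    using N_pos[of "Suc K"] by (intro ln_mono) auto
  then obtain k where k: "k \<ge> Suc K" "n k \<le> ln (pabs a)" "ln (pabs a) < n (Suc k)"
    using filterlim_at_top_crossing[OF n_at_top] by blast
  have "pabs a < N (Suc k)"
    using k(3) N_pos[of "Suc k"] a1 by (subst (asm) ln_less_cancel_iff) linarith+
  then have "1 / N (Suc k) \<le> labs (poly_T a * \<xi> + poly_T b)"
    by (rule best_approximation[OF a])
  then have "ln (1 / N (Suc k)) \<le> ln (labs (poly_T a * \<xi> + poly_T b))"
    using N_pos[of "Suc k"] by (intro ln_mono) auto
  then have "- ln (labs (poly_T a * \<xi> + poly_T b)) \<le> n (Suc k)"
    using N_pos[of "Suc k"] by (simp add: ln_div)
  then show "\<exists>k\<ge>K. n k \<le> ln (pabs a) \<and> - ln (labs (poly_T a * \<xi> + poly_T b)) \<le> n (Suc k)"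
    using k by (intro exI[of _ k]) auto
qed

text \<open>A good approximation at height \<open>H\<close> is compared with the \<open>k\<close>
  for which \<open>H\<close> lies between \<open>N k\<close> and \<open>N (Suc k)\<close>: no
  denominator up to \<open>H\<close> beats \<open>1 / N (Suc k)\<close>, so \<open>n (Suc k)\<close>
  is at least \<open>v * ln H\<close>.\<close>

lemma frequently_n_Suc_ge:
  assumes "ereal w < irrationality_exponent \<xi>" and "w > 0"
  shows "\<exists>\<^sub>F k in sequentially. w * n k \<le> n (Suc k)"
proof -
  obtain v where v: "w < v" and freq: "\<exists>\<^sub>F H in at_top. \<exists>Q. Q \<noteq> 0 \<and> pabs Q \<le> H
      \<and> dist_poly (poly_T Q * \<xi>) \<le> H powr (- v)"
    using assms(1) unfolding irrationality_exponent_def by (auto simp: less_Sup_iff)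
  show ?thesis
    unfolding frequently_sequentially
  proof
    fix K
    have "\<forall>\<^sub>F H in at_top. N K \<le> H" by (rule eventually_ge_at_top)
    from frequently_eventually_conj[OF freq this] obtain H a where
      H: "N K \<le> H" and a: "a \<noteq> 0" "pabs a \<le> H" "dist_poly (poly_T a * \<xi>) \<le> H powr (- v)"
      by (auto dest!: frequently_ex)
    have H1: "H \<ge> 1" using H N_ge_1[of K] by linarith
    have "n K \<le> ln H" using H N_pos[of K] by (intro ln_mono) auto
    then obtain k where k: "k \<ge> K" "n k \<le> ln H" "ln H < n (Suc k)"
      using filterlim_at_top_crossing[OF n_at_top] by blast
    have "pabs a < N (Suc k)"
      using a(2) k(3) H1 N_pos[of "Suc k"] by (subst (asm) ln_less_cancel_iff) linarith+
    then have "1 / N (Suc k) \<le> labs (poly_T a * \<xi> - poly_T P)" for P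
      using best_approximation[OF a(1), of k "- P"] by (simp add: poly_T_uminus)
    then have "1 / N (Suc k) \<le> dist_poly (poly_T a * \<xi>)"
      by (rule dist_poly_ge)
    also have "\<dots> \<le> exp (- (v * ln H))"
      using a(3) H1 by (simp add: powr_minus_eq_exp)
    finally have "exp (- n (Suc k)) \<le> exp (- (v * ln H))"
      by (simp add: exp_minus exp_n inverse_eq_divide)
    then have "v * ln H \<le> n (Suc k)" by simp
    moreover have "w * n k \<le> v * ln H"
      using k(2) v assms(2) n_nonneg[of k] by (intro mult_mono) auto
    ultimately show "\<exists>k\<ge>K. w * n k \<le> n (Suc k)" using k(1) by (intro exI[of _ k]) auto
  qed
qed

text \<open>\<open>R k\<close> is \<open>eps k - Q k * \<xi>\<close> with a small
  \<open>eps k\<close>, so norms of matrices built from convergents are controlled by the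
  denominators alone.\<close>

lemma pabs_R_le: "pabs (R k) \<le> max 1 (labs \<xi>) * N k"
proof -
  have "poly_T (R k) = eps k - poly_T (Q k) * \<xi>" by (simp add: eps_def)
  then have "pabs (R k) \<le> max (labs (eps k)) (N k * labs \<xi>)"
    using labs_diff_le[of "eps k" "poly_T (Q k) * \<xi>"] by (simp add: labs_mult)
  also have "\<dots> \<le> max 1 (labs \<xi>) * N k"
  proof (rule max.boundedI)
    have "labs (eps k) \<le> 1 * 1" using N_ge_1[of "Suc k"] by (simp add: labs_eps divide_le_eq_1)
    also have "1 * 1 \<le> max 1 (labs \<xi>) * N k" using N_ge_1[of k] by (intro mult_mono) auto
    finally show "labs (eps k) \<le> max 1 (labs \<xi>) * N k" .
    show "N k * labs \<xi> \<le> max 1 (labs \<xi>) * N k"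
      by (subst mult.commute) (intro mult_right_mono, auto)
  qed
  finally show ?thesis .
qed

lemma pabs_Q_le: "N k \<le> max 1 (labs \<xi>) * N k"
  using mult_right_mono[of 1 "max 1 (labs \<xi>)" "N k"] N_pos[of k] by simp

end

section \<open>Orbit points near a given point\<close>

lemma labs_lincomb_le:
  assumes "labs a \<le> M" "labs c \<le> M" "labs b \<le> W" "labs d \<le> W"
  shows "labs (a * b + c * d) \<le> M * W"
proof -
  have "M \<ge> 0" "W \<ge> 0" using assms labs_nonneg order_trans by blast+
  then have "labs (a * b) \<le> M * W" "labs (c * d) \<le> M * W"
    unfolding labs_mult using assms by (auto intro!: mult_mono)
  then show ?thesis using labs_add_le[of "a * b" "c * d"] by linarith
qed

text \<open>Lets a multiplicative constant enter the logarithmic bounds as an additive one.\<close>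

lemma le_exp_self: "C \<le> exp C" for C :: real
  using exp_ge_add_one_self[of C] by linarith

locale convergents_vector = convergents \<xi> Q R
  for \<xi> :: "'a::{field,finite} fls" and Q R :: "nat \<Rightarrow> 'a poly" +
  fixes x :: "'a fls ^ 2"
  assumes x2: "x $ 2 \<noteq> 0" and x1: "x $ 1 = \<xi> * x $ 2"
begin

lemma act_nth_slope: "act A x $ i = x $ 2 * (poly_T (A $ i $ 1) * \<xi> + poly_T (A $ i $ 2))"
  by (simp add: act_nth x1 algebra_simps)

text \<open>The rows are two consecutive convergents. The norm is of order \<open>N (Suc k)\<close>,
  and the larger of the two remainders is \<open>1 / N (Suc k)\<close>.\<close>

lemma convergent_matrix:
  "\<exists>c. \<forall>k. \<exists>A\<in>SL2. act A x \<noteq> 0 \<and> mat_labs A \<le> exp (c + n (Suc k))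
     \<and> vec_labs (act A x - 0) \<le> exp (- (n (Suc k) - c))"
proof (intro exI allI)
  fix k
  define D where "D = max 1 (labs \<xi>)"
  define c where "c = max D (labs (x $ 2))"
  let ?A = "vector [vector [Q (Suc k), R (Suc k)], vector [Q k, R k]] :: 'a poly ^ 2 ^ 2"
  have c: "D \<le> exp c" "labs (x $ 2) \<le> exp c"
    using le_exp_self[of c] by (auto simp: c_def)
  have N: "N k \<le> N (Suc k)" "N (Suc k) \<le> N (Suc (Suc k))"
    using Q_less[of k] Q_less[of "Suc k"] by auto
  have "D \<ge> 1" by (simp add: D_def)
  have "D * N k \<le> D * N (Suc k)" using N(1) \<open>D \<ge> 1\<close> by (intro mult_left_mono) auto
  then have "N k \<le> D * N (Suc k)" "pabs (R k) \<le> D * N (Suc k)"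
    using pabs_R_le[of k] pabs_Q_le[of k] unfolding D_def by linarith+
  then have "mat_labs ?A \<le> D * N (Suc k)"
    using pabs_R_le[of "Suc k"] pabs_Q_le[of "Suc k"]
    unfolding D_def[symmetric] by (simp add: mat_labs_le_iff)
  also have "\<dots> \<le> exp (c + n (Suc k))"
    using c N_pos[of "Suc k"] unfolding exp_add exp_n by (intro mult_right_mono) auto
  finally have 1: "mat_labs ?A \<le> exp (c + n (Suc k))" .
  have A: "act ?A x $ 1 = x $ 2 * eps (Suc k)" "act ?A x $ 2 = x $ 2 * eps k"
    by (simp_all add: act_nth_slope eps_def)
  have "1 / N (Suc (Suc k)) \<le> 1 / N (Suc k)"
    using N(2) N_pos by (intro divide_left_mono) auto
  then have "vec_labs (act ?A x - 0) \<le> labs (x $ 2) * (1 / N (Suc k))"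
    by (auto simp only: vec_labs_le_iff A diff_zero labs_mult labs_eps intro!: mult_left_mono)
       simp_all
  also have "\<dots> \<le> exp c * exp (- n (Suc k))"
    using c N_pos[of "Suc k"] unfolding exp_minus exp_n inverse_eq_divide
    by (intro mult_right_mono) auto
  also have "\<dots> = exp (- (n (Suc k) - c))" by (simp flip: exp_add)
  finally have 2: "vec_labs (act ?A x - 0) \<le> exp (- (n (Suc k) - c))" .
  have "act ?A x \<noteq> 0"
    using A(2) x2 eps_nonzero[of k] by force
  moreover have "?A \<in> SL2" using det[of k] by (simp add: SL2_iff)
  ultimately show "\<exists>A\<in>SL2. act A x \<noteq> 0 \<and> mat_labs A \<le> exp (c + n (Suc k))
      \<and> vec_labs (act A x - 0) \<le> exp (- (n (Suc k) - c))"
    using 1 2 by blast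
qed

text \<open>The matrix with rows \<open>t v (k + 1) - v k\<close> and \<open>v (k + 1)\<close> sends
  \<open>x\<close> close to \<open>(\<theta>, 0)\<close>, with an error of the order of the
  remainder \<open>e\<close>; the matrix with columns \<open>(p, s)\<close>, \<open>(p', s')\<close>
  moves this point near the multiple \<open>\<theta> (p, s)\<close> and costs at most a factor
  \<open>M\<close> in norm and error.\<close>

lemma orbit_point_near_multiple:
  fixes \<theta> :: "'a fls" and y :: "'a fls ^ 2"
  assumes d: "p * s' - p' * s = 1"
    and M: "pabs p \<le> M" "pabs p' \<le> M" "pabs s \<le> M" "pabs s' \<le> M"
  shows "\<exists>A\<in>SL2. act A x \<noteq> y
    \<and> mat_labs A \<le> M * (max 1 (labs \<xi>) * (N (Suc (Suc k)) * max 1 (labs (\<theta> / x $ 2) * N (Suc k))))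
    \<and> labs (act A x $ 1 - \<theta> * poly_T p) \<le> M * (labs (x $ 2) / N (Suc (Suc k)))
    \<and> labs (act A x $ 2 - \<theta> * poly_T s) \<le> M * (labs (x $ 2) / N (Suc (Suc k)))"
proof -
  define D where "D = max 1 (labs \<xi>)"
  define L where "L = \<theta> / x $ 2"
  define e e' where "e = eps (Suc k)" and "e' = eps k"
  define N0 N1 N2 where "N0 = N k" and "N1 = N (Suc k)" and "N2 = N (Suc (Suc k))"
  \<comment> \<open>Bounds \<open>pabs t * N1\<close>: the multiplier \<open>t\<close> has about the
    size of \<open>(L + e') / e\<close>, which is at most
    \<open>N2 * max (labs L) (1 / N1)\<close>.\<close>
  define W where "W = N2 * max 1 (labs L * N1)"
  note defs = D_def L_def e_def e'_def N0_def N1_def N2_def W_def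
  have N: "1 \<le> N0" "N0 < N1" "N1 < N2"
    unfolding defs by (rule N_ge_1 Q_less)+
  have D: "D \<ge> 1" by (simp add: D_def)
  have N2W: "N2 \<le> W"
    using N mult_left_mono[of 1 "max 1 (labs L * N1)" N2] by (simp add: W_def)
  have e: "labs e = 1 / N2" "labs e' = 1 / N1" "e \<noteq> 0"
    by (simp_all add: defs labs_eps eps_nonzero)
  \<comment> \<open>This choice puts \<open>t0 * e - e'\<close> within \<open>labs e\<close> of
    \<open>L\<close>.\<close>
  obtain t0 where t0: "labs ((L + e') / e - poly_T t0) < 1"
    using polynomial_part_exists by blast
  \<comment> \<open>A row of the product of the two matrices; \<open>(a, b)\<close> is a row of the
    left factor.\<close>
  define row :: "'a poly \<Rightarrow> 'a poly \<Rightarrow> 'a poly \<Rightarrow> 'a poly ^ 2" where "row t a b = vector [a * (t * Q (Suc k) - Q k) + b * Q (Suc k),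
    a * (t * R (Suc k) - R k) + b * R (Suc k)]" for t a b
  define B where "B t = (vector [row t p p', row t s s'] :: 'a poly ^ 2 ^ 2)" for t
  have B_act: "act (B t) x $ 1 = x $ 2 * (poly_T p * (poly_T t * e - e') + poly_T p' * e)"
    "act (B t) x $ 2 = x $ 2 * (poly_T s * (poly_T t * e - e') + poly_T s' * e)" for t
    by (simp_all add: act_nth_slope B_def row_def e_def e'_def eps_def poly_T_hom algebra_simps)
  \<comment> \<open>The bound \<open>\<le> 1\<close> below, instead of the strict one known for
    \<open>t0\<close>, admits \<open>t0 + 1\<close> as well.\<close>
  have good: "B t \<in> SL2 \<and> mat_labs (B t) \<le> M * (D * W)
    \<and> labs (act (B t) x $ 1 - \<theta> * poly_T p) \<le> M * (labs (x $ 2) / N2)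
    \<and> labs (act (B t) x $ 2 - \<theta> * poly_T s) \<le> M * (labs (x $ 2) / N2)"
    if t: "labs ((L + e') / e - poly_T t) \<le> 1" for t
  proof (intro conjI)
    have "det (B t) = (p * s' - p' * s) * (Q (Suc k) * R k - R (Suc k) * Q k)"
      by (simp add: det_2 B_def row_def algebra_simps)
    then show "B t \<in> SL2" using d det by (simp add: SL2_def)
    have "labs ((L + e') / e) \<le> N2 * max (labs L) (1 / N1)"
      using labs_add_le[of L e'] N e by (simp add: labs_divide mult.commute)
    moreover have "pabs t \<le> max (labs ((L + e') / e)) 1"
      using labs_diff_le[of "(L + e') / e" "(L + e') / e - poly_T t"] t by simp
    ultimately have "pabs t \<le> max (N2 * max (labs L) (1 / N1)) 1" by linarith
    then have "pabs t * N1 \<le> max (N2 * max (labs L) (1 / N1)) 1 * N1"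
      using N by (intro mult_right_mono) auto
    also have "\<dots> = max (N2 * max (labs L * N1) 1) N1"
      using N by (simp add: max_mult_distrib_right mult.assoc)
    also have "\<dots> = max W N1" by (simp add: W_def max.commute)
    also have "\<dots> \<le> W" using N N2W by simp
    finally have tN: "pabs t * N1 \<le> W" .
    have Q_bd: "pabs (t * Q (Suc k) - Q k) \<le> D * W"
    proof -
      have "pabs (t * Q (Suc k) - Q k) \<le> max (pabs t * N1) N0"
        using labs_diff_le[of "poly_T t * poly_T (Q (Suc k))" "poly_T (Q k)"]
        by (simp add: poly_T_hom labs_mult N1_def N0_def)
      also have "\<dots> \<le> 1 * W" using tN N N2W by simp
      also have "\<dots> \<le> D * W" using D N N2W by (intro mult_right_mono) auto
      finally show ?thesis .
    qed
    have R_bd: "pabs (t * R (Suc k) - R k) \<le> D * W"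
    proof -
      have "pabs (t * R (Suc k) - R k) \<le> max (pabs t * pabs (R (Suc k))) (pabs (R k))"
        using labs_diff_le[of "poly_T t * poly_T (R (Suc k))" "poly_T (R k)"]
        by (simp add: poly_T_hom labs_mult)
      also have "\<dots> \<le> max (pabs t * (D * N1)) (D * N0)"
        using pabs_R_le[of k] pabs_R_le[of "Suc k"] unfolding defs
        by (intro max.mono mult_left_mono) auto
      also have "\<dots> = D * max (pabs t * N1) N0"
        using D by (simp add: max_mult_distrib_left mult.left_commute)
      also have "\<dots> \<le> D * W" using tN N N2W D by (intro mult_left_mono) auto
      finally show ?thesis .
    qed
    have "D * N1 \<le> D * W" using D N N2W by (intro mult_left_mono) auto
    then have "N (Suc k) \<le> D * W" "pabs (R (Suc k)) \<le> D * W"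
      using pabs_Q_le[of "Suc k"] pabs_R_le[of "Suc k"] unfolding D_def N1_def by linarith+
    then show "mat_labs (B t) \<le> M * (D * W)"
      using Q_bd R_bd M
      by (simp add: mat_labs_le_iff B_def row_def labs_lincomb_le poly_T_add poly_T_mult)
    have "poly_T t * e - e' - L = - ((L + e') / e - poly_T t) * e"
      using e by (simp add: field_simps)
    then have "labs (poly_T t * e - e' - L) = labs ((L + e') / e - poly_T t) * labs e"
      by (simp only: labs_mult labs_minus)
    also have "\<dots> \<le> 1 * labs e" using t by (intro mult_right_mono) auto
    finally have err: "labs (poly_T t * e - e' - L) \<le> labs e" by simp
    have \<theta>: "\<theta> = x $ 2 * L" using x2 by (simp add: L_def)
    have "act (B t) x $ 1 - \<theta> * poly_T p
        = x $ 2 * (poly_T p * (poly_T t * e - e' - L) + poly_T p' * e)"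
      "act (B t) x $ 2 - \<theta> * poly_T s
        = x $ 2 * (poly_T s * (poly_T t * e - e' - L) + poly_T s' * e)"
      by (simp_all add: B_act \<theta> algebra_simps)
    moreover have "labs (poly_T p * (poly_T t * e - e' - L) + poly_T p' * e) \<le> M * labs e"
      "labs (poly_T s * (poly_T t * e - e' - L) + poly_T s' * e) \<le> M * labs e"
      using M err by (auto intro!: labs_lincomb_le)
    then have "labs (x $ 2) * labs (poly_T p * (poly_T t * e - e' - L) + poly_T p' * e)
        \<le> labs (x $ 2) * (M * labs e)"
      "labs (x $ 2) * labs (poly_T s * (poly_T t * e - e' - L) + poly_T s' * e)
        \<le> labs (x $ 2) * (M * labs e)"
      by (auto intro!: mult_left_mono)
    moreover have "labs (x $ 2) * (M * labs e) = M * (labs (x $ 2) / N2)"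
      by (simp add: e)
    ultimately show "labs (act (B t) x $ 1 - \<theta> * poly_T p) \<le> M * (labs (x $ 2) / N2)"
      "labs (act (B t) x $ 2 - \<theta> * poly_T s) \<le> M * (labs (x $ 2) / N2)"
      by (simp_all only: labs_mult)
  qed
  have "labs ((L + e') / e - poly_T (t0 + 1)) \<le> 1"
    using labs_diff_le[of "(L + e') / e - poly_T t0" 1] t0
    by (simp add: poly_T_add diff_diff_eq)
  note good1 = good[OF this]
  note good0 = good[OF less_imp_le[OF t0]]
  \<comment> \<open>Both choices of the multiplier satisfy the bounds, and they yield different orbit points.\<close>
  have "act (B (t0 + 1)) x \<noteq> act (B t0) x"
  proof
    assume eq: "act (B (t0 + 1)) x = act (B t0) x"
    have "p \<noteq> 0 \<or> s \<noteq> 0" using d by auto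
    moreover have "act (B (t0 + 1)) x $ 1 - act (B t0) x $ 1 = x $ 2 * (poly_T p * e)"
      "act (B (t0 + 1)) x $ 2 - act (B t0) x $ 2 = x $ 2 * (poly_T s * e)"
      by (simp_all add: B_act poly_T_add algebra_simps)
    ultimately show False using eq x2 e by auto
  qed
  then consider "act (B t0) x \<noteq> y" | "act (B (t0 + 1)) x \<noteq> y" by metis
  then show ?thesis
    using good0 good1 unfolding defs by cases blast+
qed

text \<open>Here \<open>y\<close> itself is the multiple \<open>\<theta> (p, s)\<close>, so
  \<open>M\<close> is a constant: the height is of order \<open>N (k + 1) * N (k + 2)\<close> and
  the error of order \<open>1 / N (k + 2)\<close>.\<close>

lemma rational_target:
  fixes y :: "'a fls ^ 2"
  assumes d: "p * s' - p' * s = 1"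
    and y: "y $ 1 = \<theta> * poly_T p" "y $ 2 = \<theta> * poly_T s"
  shows "\<exists>c. \<forall>k. \<exists>A\<in>SL2. act A x \<noteq> y
    \<and> mat_labs A \<le> exp (c + n (Suc k) + n (Suc (Suc k)))
    \<and> vec_labs (act A x - y) \<le> exp (- (n (Suc (Suc k)) - c))"
proof (intro exI allI)
  fix k
  define M where "M = max (max (pabs p) (pabs p')) (max (pabs s) (pabs s'))"
  define D where "D = max 1 (labs \<xi>)"
  define E where "E = max 1 (labs (\<theta> / x $ 2))"
  define c where "c = max (M * (D * E)) (M * labs (x $ 2))"
  have M: "pabs p \<le> M" "pabs p' \<le> M" "pabs s \<le> M" "pabs s' \<le> M" by (auto simp: M_def)
  have pos: "M \<ge> 0" "D \<ge> 1" "E \<ge> 1" using M(1) labs_nonneg[of "poly_T p"] by (auto simp: D_def E_def simp del: labs_nonneg)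
  have c: "M * (D * E) \<le> exp c" "M * labs (x $ 2) \<le> exp c"
    using le_exp_self[of c] by (auto simp: c_def)
  obtain A where A: "A \<in> SL2" "act A x \<noteq> y"
    "mat_labs A \<le> M * (D * (N (Suc (Suc k)) * max 1 (labs (\<theta> / x $ 2) * N (Suc k))))"
    "labs (act A x $ 1 - \<theta> * poly_T p) \<le> M * (labs (x $ 2) / N (Suc (Suc k)))"
    "labs (act A x $ 2 - \<theta> * poly_T s) \<le> M * (labs (x $ 2) / N (Suc (Suc k)))"
    using orbit_point_near_multiple[OF d M] unfolding D_def by blast
  have "max 1 (labs (\<theta> / x $ 2) * N (Suc k)) \<le> E * N (Suc k)"
  proof (rule max.boundedI)
    show "1 \<le> E * N (Suc k)" using mult_mono[of 1 E 1 "N (Suc k)"] pos N_ge_1[of "Suc k"] by simp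
    show "labs (\<theta> / x $ 2) * N (Suc k) \<le> E * N (Suc k)"
      by (intro mult_right_mono) (auto simp: E_def)
  qed
  then have "M * (D * (N (Suc (Suc k)) * max 1 (labs (\<theta> / x $ 2) * N (Suc k))))
      \<le> M * (D * (N (Suc (Suc k)) * (E * N (Suc k))))"
    using pos by (intro mult_left_mono) auto
  also have "\<dots> = M * (D * E) * N (Suc k) * N (Suc (Suc k))" by (simp add: mult_ac)
  also have "\<dots> \<le> exp c * N (Suc k) * N (Suc (Suc k))"
    using c by (intro mult_right_mono) auto
  also have "\<dots> = exp (c + n (Suc k) + n (Suc (Suc k)))"
    by (simp only: exp_add exp_n)
  finally have 1: "mat_labs A \<le> exp (c + n (Suc k) + n (Suc (Suc k)))" using A(3) by linarith
  have "M * (labs (x $ 2) / N (Suc (Suc k))) = M * labs (x $ 2) * exp (- n (Suc (Suc k)))"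
    by (simp add: exp_minus exp_n divide_inverse)
  also have "\<dots> \<le> exp c * exp (- n (Suc (Suc k)))"
    using c by (intro mult_right_mono) auto
  also have "\<dots> = exp (- (n (Suc (Suc k)) - c))" by (simp flip: exp_add)
  finally have "vec_labs (act A x - y) \<le> exp (- (n (Suc (Suc k)) - c))"
    using A(4,5) by (simp add: vec_labs_le_iff y)
  then show "\<exists>A\<in>SL2. act A x \<noteq> y
    \<and> mat_labs A \<le> exp (c + n (Suc k) + n (Suc (Suc k)))
    \<and> vec_labs (act A x - y) \<le> exp (- (n (Suc (Suc k)) - c))"
    using A 1 by blast
qed

text \<open>The target is replaced by a multiple of a convergent of its slope. The minimum collects
  two errors: that of the orbit point, amplified by the denominator of the convergent, and that of
  the replacement.\<close>

lemma irrational_target: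
  fixes y :: "'a fls ^ 2"
  assumes conv: "convergents \<eta> Q' R'" and y: "y $ 2 \<noteq> 0" "y $ 1 = \<eta> * y $ 2"
  shows "\<exists>c. \<forall>j k. \<exists>A\<in>SL2. act A x \<noteq> y
    \<and> mat_labs A \<le> exp (c + n (Suc (Suc k)) + max (ln (pabs (Q' (Suc j)))) (n (Suc k)))
    \<and> vec_labs (act A x - y) \<le> exp (- (min (n (Suc (Suc k)) - ln (pabs (Q' (Suc j))))
        (ln (pabs (Q' (Suc j))) + ln (pabs (Q' (Suc (Suc j))))) - c))"
proof (intro exI allI)
  fix j k
  interpret y: convergents \<eta> Q' R' by (rule conv)
  define C where "C = max 1 (labs \<eta>)"
  define D where "D = max 1 (labs \<xi>)"
  define E where "E = max 1 (labs (y $ 2) / labs (x $ 2))"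
  define c where "c = max (C * (D * E)) (max (C * labs (x $ 2)) (labs (y $ 2)))"
  define S S' where "S = pabs (Q' (Suc j))" and "S' = pabs (Q' (Suc (Suc j)))"
  define Z X where "Z = N (Suc k)" and "X = N (Suc (Suc k))"
  have pos: "C \<ge> 1" "D \<ge> 1" "E \<ge> 1" "S \<ge> 1" "S' \<ge> 1" "Z \<ge> 1" "X \<ge> 1"
    unfolding C_def D_def E_def S_def S'_def Z_def X_def by (auto intro: N_ge_1 y.N_ge_1)
  have c: "C * (D * E) \<le> exp c" "C * labs (x $ 2) \<le> exp c" "labs (y $ 2) \<le> exp c"
    using le_exp_self[of c] by (auto simp: c_def)
  \<comment> \<open>The numerators are \<open>- R'\<close>, so both entries of the first row carry
    the sign.\<close>
  have d: "- R' (Suc j) * Q' j - (- R' j) * Q' (Suc j) = 1"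
    using y.det[of j] by (simp add: algebra_simps)
  have "pabs (Q' j) \<le> S" using y.Q_less[of j] by (simp add: S_def)
  then have CS: "C * pabs (Q' j) \<le> C * S" using pos by (intro mult_left_mono) auto
  then have M: "pabs (- R' (Suc j)) \<le> C * S" "pabs (- R' j) \<le> C * S"
    "pabs (Q' (Suc j)) \<le> C * S" "pabs (Q' j) \<le> C * S"
    using y.pabs_R_le[of j] y.pabs_R_le[of "Suc j"] y.pabs_Q_le[of j] y.pabs_Q_le[of "Suc j"]
    unfolding C_def[symmetric] S_def[symmetric] by (simp_all add: poly_T_uminus)
  define \<theta> where "\<theta> = y $ 2 / poly_T (Q' (Suc j))"
  have \<theta>: "labs (\<theta> / x $ 2) = labs (y $ 2) / labs (x $ 2) / S"
    by (simp add: \<theta>_def labs_divide labs_mult S_def)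
  obtain A where A: "A \<in> SL2" "act A x \<noteq> y"
    "mat_labs A \<le> C * S * (D * (X * max 1 (labs (\<theta> / x $ 2) * Z)))"
    "labs (act A x $ 1 - \<theta> * poly_T (- R' (Suc j))) \<le> C * S * (labs (x $ 2) / X)"
    "labs (act A x $ 2 - \<theta> * poly_T (Q' (Suc j))) \<le> C * S * (labs (x $ 2) / X)"
    using orbit_point_near_multiple[OF d M] unfolding D_def X_def Z_def by blast
  \<comment> \<open>The factor \<open>S\<close> coming from the bound \<open>C * S\<close> on the
    entries cancels the \<open>1 / S\<close> in \<theta> and leaves the larger of \<open>S\<close>
    and \<open>Z\<close>.\<close>
  have "S * max 1 (labs (\<theta> / x $ 2) * Z) \<le> E * max S Z"
  proof -
    have "S * max 1 (labs (\<theta> / x $ 2) * Z) = max S (labs (y $ 2) / labs (x $ 2) * Z)"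
      using pos unfolding \<theta> by (simp add: max_mult_distrib_left)
    also have "\<dots> \<le> E * max S Z"
    proof (rule max.boundedI)
      have "1 * S \<le> E * max S Z" using pos by (intro mult_mono) auto
      then show "S \<le> E * max S Z" by simp
      show "labs (y $ 2) / labs (x $ 2) * Z \<le> E * max S Z"
        using pos by (intro mult_mono) (auto simp: E_def)
    qed
    finally show ?thesis .
  qed
  then have "C * D * X * (S * max 1 (labs (\<theta> / x $ 2) * Z)) \<le> C * D * X * (E * max S Z)"
    using pos by (intro mult_left_mono) auto
  then have "mat_labs A \<le> C * (D * E) * X * max S Z"
    using A(3) by (simp add: mult_ac)
  also have "\<dots> \<le> exp c * X * max S Z"
    using c pos by (intro mult_right_mono) auto
  also have "max S Z = exp (max (ln S) (ln Z))"
    using pos by (simp add: max_def)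
  also have "exp c * X * exp (max (ln S) (ln Z)) = exp (c + ln X + max (ln S) (ln Z))"
    using pos by (simp add: exp_add)
  finally have 1: "mat_labs A \<le> exp (c + ln X + max (ln S) (ln Z))" .
  let ?g = "min (ln X - ln S) (ln S + ln S') - c"
  have "C * S * (labs (x $ 2) / X) = (C * labs (x $ 2)) * (S / X)" by simp
  also have "\<dots> \<le> exp c * (S / X)"
    using c pos by (intro mult_right_mono) auto
  also have "\<dots> = exp (- (ln X - ln S - c))"
    using pos by (simp add: exp_diff exp_add exp_minus field_simps)
  also have "\<dots> \<le> exp (- ?g)" by simp
  finally have near: "C * S * (labs (x $ 2) / X) \<le> exp (- ?g)" .
  \<comment> \<open>The first coordinate misses by order \<open>1 / (S * S')\<close>; the choice of
    \<theta> makes the second one exact.\<close>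
  have "y $ 1 - \<theta> * poly_T (- R' (Suc j)) = y $ 2 / poly_T (Q' (Suc j)) * y.eps (Suc j)"
    using y.Q_nonzero[of "Suc j"] by (simp add: \<theta>_def y y.eps_def poly_T_uminus field_simps)
  then have "labs (y $ 1 - \<theta> * poly_T (- R' (Suc j))) = labs (y $ 2) * (1 / (S * S'))"
    by (simp add: labs_mult labs_divide y.labs_eps S_def S'_def)
  also have "\<dots> \<le> exp c * (1 / (S * S'))"
    using c pos by (intro mult_right_mono) auto
  also have "\<dots> = exp (- (ln S + ln S' - c))"
    using pos by (simp add: exp_diff exp_add exp_minus field_simps)
  also have "\<dots> \<le> exp (- ?g)" by simp
  finally have "labs (act A x $ 1 - y $ 1) \<le> exp (- ?g)"
    using A(4) near labs_diff_le[of "act A x $ 1 - \<theta> * poly_T (- R' (Suc j))" "y $ 1 - \<theta> * poly_T (- R' (Suc j))"]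
    by simp
  moreover have "\<theta> * poly_T (Q' (Suc j)) = y $ 2"
    using y.Q_nonzero[of "Suc j"] by (simp add: \<theta>_def)
  ultimately have "vec_labs (act A x - y) \<le> exp (- ?g)"
    using A(5) near by (simp add: vec_labs_le_iff)
  then show "\<exists>A\<in>SL2. act A x \<noteq> y
    \<and> mat_labs A \<le> exp (c + n (Suc (Suc k)) + max (ln (pabs (Q' (Suc j)))) (n (Suc k)))
    \<and> vec_labs (act A x - y) \<le> exp (- (min (n (Suc (Suc k)) - ln (pabs (Q' (Suc j))))
        (ln (pabs (Q' (Suc j))) + ln (pabs (Q' (Suc (Suc j))))) - c))"
    using A 1 unfolding S_def S'_def X_def Z_def by blast
qed

end

section \<open>Extended real exponents\<close>

text \<open>This lemma and its variants trade a strict comparison of extended reals for a real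
  \<open>w\<close> on one side of \<omega> and a strict real inequality, whose slack later absorbs
  constants. An infinite \<omega> is treated apart.\<close>

lemma ereal_one_divide_less:
  assumes "1 \<le> \<omega>" "1 / \<omega> < ereal m"
  shows "\<exists>w>0. ereal w < \<omega> \<and> 1 < m * w"
proof (cases \<omega>)
  case (real r)
  then have r: "r \<ge> 1" "1 / r < m" using assms by (auto simp: one_ereal_def)
  then have m: "m > 0" by (smt (verit) divide_pos_pos)
  then have "1 / m < r" using r by (simp add: field_simps)
  then obtain w where w: "1 / m < w" "w < r" using dense by blast
  have "1 < m * w" using w m by (simp add: field_simps)
  then show ?thesis using w m real by (intro exI[of _ w]) (auto intro: less_trans[of _ "1 / m"])
next
  case PInf
  then have "m > 0" using assms by simp
  then show ?thesis using PInf by (intro exI[of _ "2 / m"]) auto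
qed (use assms in auto)

lemma ereal_less_one_divide:
  assumes "1 \<le> \<omega>" "0 < m" "ereal m < 1 / \<omega>"
  shows "\<exists>w>0. \<omega> < ereal w \<and> m * w < 1"
proof (cases \<omega>)
  case (real r)
  then have r: "r \<ge> 1" "m < 1 / r" using assms by (auto simp: one_ereal_def)
  then have "r < 1 / m" using assms(2) by (simp add: field_simps)
  then obtain w where w: "r < w" "w < 1 / m" using dense by blast
  have "m * w < 1" using w assms(2) by (simp add: field_simps)
  then show ?thesis using w r real by (intro exI[of _ w]) auto
qed (use assms in auto)

lemma ereal_one_divide_plus_1_less:
  assumes "1 \<le> \<omega>" "1 / (\<omega> + 1) < ereal m"
  shows "\<exists>w>0. ereal w < \<omega> \<and> 1 < m * (w + 1)"
proof (cases \<omega>)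
  case (real r)
  then have r: "r \<ge> 1" "1 / (r + 1) < m" using assms by (auto simp: one_ereal_def)
  then have m: "m > 0" by (smt (verit) divide_pos_pos)
  then have "max 0 (1 / m - 1) < r" using r by (simp add: field_simps)
  then obtain w where w: "max 0 (1 / m - 1) < w" "w < r" using dense by blast
  have "1 < m * (w + 1)" using w m by (simp add: field_simps)
  then show ?thesis using w m real by (intro exI[of _ w]) auto
next
  case PInf
  then have "m > 0" using assms by simp
  then show ?thesis using PInf by (intro exI[of _ "2 / m"]) (auto simp: distrib_left)
qed (use assms in auto)

lemma ereal_less_one_divide_plus_1:
  assumes "1 \<le> \<omega>" "0 < m" "ereal m < 1 / (\<omega> + 1)"
  shows "\<exists>w>0. \<omega> < ereal w \<and> m * (w + 1) < 1"
proof (cases \<omega>)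
  case (real r)
  then have r: "r \<ge> 1" "m < 1 / (r + 1)" using assms by (auto simp: one_ereal_def)
  then have "r < 1 / m - 1" using assms(2) by (simp add: field_simps)
  then obtain w where w: "r < w" "w < 1 / m - 1" using dense by blast
  have "m * (w + 1) < 1" using w assms(2) by (simp add: field_simps)
  then show ?thesis using w r real by (intro exI[of _ w]) auto
qed (use assms in auto)

lemma ereal_less_rational_slope_mu:
  assumes "1 \<le> \<omega>" "0 < m" "ereal m < rational_slope_mu \<omega>"
  shows "\<exists>w>0. ereal w < \<omega> \<and> m * (w + 1) < w"
proof (cases \<omega>)
  case (real r)
  then have r: "r \<ge> 1" "m < r / (r + 1)"
    using assms by (auto simp: one_ereal_def rational_slope_mu_def)
  then have "m * (r + 1) < r" by (simp add: field_simps)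
  moreover have "r / (r + 1) < 1" using r by simp
  \<comment> \<open>\<open>m * (w + 1) < w\<close> solved for \<open>w\<close>; the same threshold
    gives the witness for infinite \<omega>.\<close>
  ultimately have m: "m < 1" "m / (1 - m) < r"
    using r(2) by (linarith, subst pos_divide_less_eq) (auto simp: algebra_simps)
  then obtain w where w: "m / (1 - m) < w" "w < r" using dense by blast
  have "m * (w + 1) < w" using w m by (simp add: field_simps)
  moreover have "0 < m / (1 - m)" using m assms by simp
  ultimately show ?thesis using w real by (intro exI[of _ w]) auto
next
  case PInf
  then have m: "m < 1" using assms by (simp add: rational_slope_mu_def)
  have pos: "0 < m / (1 - m)" using m assms by simp
  have "m / (1 - m) * (1 - m) = m" using m by simp
  then have "m * (m / (1 - m) + 1 + 1) < m / (1 - m) + 1"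
    using m by (simp only: algebra_simps)
  then show ?thesis using PInf pos by (intro exI[of _ "m / (1 - m) + 1"]) auto
qed (use assms in auto)

text \<open>\<kappa> is the inverse of a real above \<omega>, to be used as
  \<open>\<kappa> * n (Suc k) \<le> n k\<close>; the value 0 serves an infinite \<omega>.\<close>

lemma rational_slope_mu_less_ereal:
  assumes "1 \<le> \<omega>" "rational_slope_mu \<omega> < ereal m"
  shows "m > 0 \<and> (\<exists>\<kappa>\<ge>0. 1 < m * (1 + \<kappa>) \<and> (\<kappa> = 0 \<or> \<omega> < ereal (1 / \<kappa>)))"
proof (cases \<omega>)
  case (real r)
  then have r: "r \<ge> 1" "r / (r + 1) < m"
    using assms by (auto simp: one_ereal_def rational_slope_mu_def)
  then have m: "m > 0" by (smt (verit) divide_pos_pos)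
  then have "max 0 (1 / m - 1) < 1 / r" using r by (simp add: field_simps)
  then obtain k where k: "max 0 (1 / m - 1) < k" "k < 1 / r" using dense by blast
  have "1 < m * (1 + k)" using k m by (simp add: field_simps)
  moreover have "r < 1 / k" using k r by (simp add: field_simps)
  ultimately show ?thesis using k m real by (intro conjI exI[of _ k]) auto
next
  case PInf
  then show ?thesis using assms by (auto simp: rational_slope_mu_def intro!: exI[of _ 0])
qed (use assms in auto)

text \<open>The slack in \<open>m\<close> is spent on moving both exponents upwards. The value
  \<open>1 / 2\<close> is the limit of \<open>(v' + 1) / (2 * v' + 1)\<close> and serves an infinite
  \<open>v\<close>.\<close>

lemma ereal_less_irrational_slope_bound:
  assumes "1 \<le> \<omega>" "1 \<le> v" "0 < m" "ereal m < irrational_slope_mu_hat_bound \<omega> v"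
  shows "\<exists>w \<beta>. \<omega> < ereal w \<and> 0 < w \<and> 2 * m * w < \<beta>
    \<and> (\<beta> = 1 / 2 \<or> (\<exists>v'>0. v < ereal v' \<and> \<beta> = (v' + 1) / (2 * v' + 1)))"
proof (cases \<omega>)
  case (real r)
  show ?thesis
  proof (cases v)
    case v: (real s)
    have s: "s \<ge> 1" "r \<ge> 1" and "m < (s + 1) / (2 * (2 * s + 1) * r)"
      using assms real v by (auto simp: one_ereal_def irrational_slope_mu_hat_bound_def)
    then have "m * (2 * (2 * s + 1) * r) < s + 1"
      by (subst (asm) pos_less_divide_eq) (auto simp: mult_pos_pos)
    then have "r < (s + 1) / (2 * (2 * s + 1) * m)"
      using s assms(3) by (subst pos_less_divide_eq) (simp_all add: mult_ac)
    then obtain w where w: "r < w" "w < (s + 1) / (2 * (2 * s + 1) * m)" using dense by blast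
    then have "w * (2 * (2 * s + 1) * m) < s + 1"
      using s assms(3) by (subst (asm) pos_less_divide_eq) auto
    then have \<phi>: "s + 1 - 2 * m * w * (2 * s + 1) > 0" (is "?\<phi> > 0") by (simp add: algebra_simps)
    \<comment> \<open>Raising \<open>s\<close> by \<open>u\<close> uses up at most half of the
      slack.\<close>
    define u where "u = ?\<phi> / (2 * (1 + 4 * m * w))"
    have mw: "m * w > 0" using w s assms(3) by simp
    have "1 + 4 * m * w > 0" using mw by simp
    then have u: "u > 0" "(1 + 4 * m * w) * u = ?\<phi> / 2"
      using \<phi> unfolding u_def by (simp_all del: distrib_left_numeral add: divide_simps)
    have "(s + u) + 1 - 2 * m * w * (2 * (s + u) + 1) = ?\<phi> - (1 + 4 * m * w) * u + 2 * u"
      by (simp add: algebra_simps)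
    also have "\<dots> = ?\<phi> / 2 + 2 * u"
    proof -
      have "a - a / 2 + b = a / 2 + b" for a b :: real by simp
      then show ?thesis unfolding u(2) .
    qed
    also have "\<dots> > 0" using u(1) \<phi> by (intro add_pos_pos) auto
    finally have "2 * m * w * (2 * (s + u) + 1) < (s + u) + 1" by (simp only: diff_gt_0_iff_gt)
    then have "2 * m * w < (s + u + 1) / (2 * (s + u) + 1)"
      using s u by (simp add: field_simps)
    then show ?thesis
      using w s u real v by (intro exI[of _ w] exI[of _ "(s + u + 1) / (2 * (s + u) + 1)"])
        (auto intro!: exI[of _ "s + u"])
  next
    case PInf
    have r: "r \<ge> 1" "m < 1 / (4 * r)"
      using assms real PInf by (auto simp: one_ereal_def irrational_slope_mu_hat_bound_def)
    then have "r < 1 / (4 * m)" using assms(3) by (simp add: field_simps)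
    then obtain w where w: "r < w" "w < 1 / (4 * m)" using dense by blast
    have "2 * m * w < 1 / 2" using w assms(3) by (simp add: field_simps)
    then show ?thesis using w r real by (intro exI[of _ w] exI[of _ "1 / 2"]) auto
  qed (use assms in auto)
next
  case PInf
  then show ?thesis using assms
    by (cases v) (auto simp: irrational_slope_mu_hat_bound_def one_ereal_def split: if_splits)
qed (use assms in auto)

text \<open>The factor \<open>(v + 1) / (2 * v + 1)\<close> stays above \<open>1 / 2\<close>, its
  limit at infinity.\<close>

lemma irrational_slope_bound_ge:
  assumes "1 \<le> \<omega>" "1 \<le> v"
  shows "1 / (4 * \<omega>) \<le> irrational_slope_mu_hat_bound \<omega> v"
proof (cases \<omega>)
  case (real r)
  show ?thesis
  proof (cases v)
    case v: (real s)
    have "s \<ge> 1" "r \<ge> 1" using assms real v by (auto simp: one_ereal_def)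
    moreover have "1 / (4 * r) \<le> (s + 1) / (2 * (2 * s + 1) * r)"
    proof -
      have "1 / 2 \<le> (s + 1) / (2 * s + 1)" using \<open>s \<ge> 1\<close> by (simp add: field_simps)
      then have "1 / 2 * (1 / (2 * r)) \<le> (s + 1) / (2 * s + 1) * (1 / (2 * r))"
        using \<open>r \<ge> 1\<close> by (intro mult_right_mono) auto
      moreover have "(s + 1) / (2 * s + 1) * (1 / (2 * r)) = (s + 1) / (2 * (2 * s + 1) * r)"
        by (simp only: times_divide_times_eq mult_1_right mult_ac)
      moreover have "1 / 2 * (1 / (2 * r)) = 1 / (4 * r)" by simp
      ultimately show ?thesis by (simp only:)
    qed
    ultimately show ?thesis
      by (simp add: real v irrational_slope_mu_hat_bound_def one_ereal_def)
  qed (use assms in \<open>auto simp: irrational_slope_mu_hat_bound_def\<close>)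
next
  case PInf
  then show ?thesis using assms
    by (cases v) (auto simp: irrational_slope_mu_hat_bound_def one_ereal_def)
qed (use assms in auto)

section \<open>Computation of the exponents\<close>

text \<open>Meant for the slope of the target, with \<open>h\<close> the logarithm of a denominator
  for \<open>x\<close>: both errors in \<open>irrational_target\<close> then have exponent at least
  \<open>\<beta> * h\<close>. The index is one where \<open>n\<close> crosses
  \<open>(1 - \<beta>) * h\<close>.\<close>

lemma (in convergents) window:
  assumes "\<beta> = 1 / 2 \<or> (\<exists>v>0. irrationality_exponent \<xi> < ereal v \<and> \<beta> = (v + 1) / (2 * v + 1))"
  shows "\<forall>\<^sub>F h in at_top. \<exists>j. n (Suc j) \<le> (1 - \<beta>) * h \<and> \<beta> * h \<le> n (Suc j) + n (Suc (Suc j))"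
proof -
  have at_top: "filterlim (\<lambda>j. n (Suc j)) at_top sequentially"
    using n_Suc_at_top[of 1] by simp
  show ?thesis using assms
  proof
    assume \<beta>: "\<beta> = 1 / 2"
    show ?thesis using eventually_ge_at_top[of "2 * n (Suc 0)"]
    proof eventually_elim
      case (elim h)
      then have "n (Suc 0) \<le> h / 2" by simp
      from filterlim_at_top_crossing[OF at_top this] obtain j
        where "n (Suc j) \<le> h / 2" "h / 2 < n (Suc (Suc j))" by blast
      then show ?case unfolding \<beta> using n_nonneg[of "Suc j"] by (intro exI[of _ j]) auto
    qed
  next
    assume "\<exists>v>0. irrationality_exponent \<xi> < ereal v \<and> \<beta> = (v + 1) / (2 * v + 1)"
    then obtain v where v: "v > 0" "irrationality_exponent \<xi> < ereal v"
      and \<beta>: "\<beta> = (v + 1) / (2 * v + 1)" by blast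
    obtain K where K: "\<And>j. j \<ge> K \<Longrightarrow> n (Suc j) \<le> v * n j"
      using eventually_n_Suc_le[OF v(2)] by (auto simp: eventually_sequentially)
    show ?thesis using eventually_ge_at_top[of "n (Suc K) / v * (2 * v + 1)"]
    proof eventually_elim
      case (elim h)
      \<comment> \<open>In this unit the thresholds are \<open>v * u\<close> and
        \<open>(v + 1) * u\<close>. A crossing at \<open>v * u\<close> gives
        \<open>n (Suc (Suc j)) > v * u\<close>, and growth by at most the factor \<open>v\<close>
        gives \<open>n (Suc j) > u\<close>.\<close>
      define u where "u = h / (2 * v + 1)"
      have h: "\<beta> * h = (v + 1) * u" "(1 - \<beta>) * h = v * u"
        using v by (simp_all add: \<beta> u_def field_simps)
      have "n (Suc K) / v \<le> u" using elim v unfolding u_def by (subst pos_le_divide_eq) auto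
      then have "n (Suc K) \<le> v * u" using v by (simp add: field_simps)
      from filterlim_at_top_crossing[OF at_top this] obtain j
        where j: "j \<ge> K" "n (Suc j) \<le> v * u" "v * u < n (Suc (Suc j))" by blast
      have "v * u < v * n (Suc j)" using j K[of "Suc j"] by simp
      then have "u < n (Suc j)" using v by simp
      then show ?case using j unfolding h by (intro exI[of _ j]) (auto simp: algebra_simps)
    qed
  qed
qed

section \<open>Target zero and targets of irrational slope\<close>

context convergents_vector
begin

text \<open>By Cramer's rule a matrix of determinant 1 recovers \<open>x $ 2\<close> from the image
  of \<open>x\<close>, so the image is at least a constant over the norm.
  \<open>convergent_matrix\<close> attains this order.\<close>

theorem mu_zero: "mu x 0 = 1"
proof (rule antisym)
  show "mu x 0 \<le> 1"
  proof (rule mu_le)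
    fix m assume "1 < ereal m"
    then have m: "m > 1" by (simp add: one_ereal_def)
    show "\<exists>G. \<forall>A\<in>SL2. vec_labs (act A x - 0) \<le> mat_labs A powr (- m) \<longrightarrow> mat_labs A \<le> G"
    proof (intro exI ballI impI)
      fix A :: "'a poly ^ 2 ^ 2"
      assume A: "A \<in> SL2" and small: "vec_labs (act A x - 0) \<le> mat_labs A powr (- m)"
      have A1: "mat_labs A \<ge> 1" using A by (rule SL2_mat_labs_ge_1)
      have "poly_T (A $ 1 $ 1) * act A x $ 2 + poly_T (- A $ 2 $ 1) * act A x $ 1
          = poly_T (A $ 1 $ 1 * A $ 2 $ 2 - A $ 1 $ 2 * A $ 2 $ 1) * x $ 2"
        by (simp add: act_nth poly_T_hom algebra_simps)
      also have "\<dots> = x $ 2" using A by (simp add: SL2_iff)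
      finally have "labs (x $ 2) \<le> mat_labs A * vec_labs (act A x - 0)"
        using mat_labs_le_iff[of A "mat_labs A"] vec_labs_le_iff[of "act A x" "vec_labs (act A x)"]
          labs_lincomb_le[of "poly_T (A $ 1 $ 1)" "mat_labs A" "poly_T (- A $ 2 $ 1)"
            "act A x $ 2" "vec_labs (act A x)" "act A x $ 1"]
        by (simp add: poly_T_uminus)
      also have "\<dots> \<le> mat_labs A * mat_labs A powr (- m)"
        using small A1 by (intro mult_left_mono) auto
      also have "\<dots> = exp (ln (mat_labs A) * (1 - m))"
        using A1 by (simp add: powr_minus_eq_exp exp_add exp_diff algebra_simps exp_minus field_simps)
      finally have "ln (labs (x $ 2)) \<le> ln (exp (ln (mat_labs A) * (1 - m)))"
        using x2 by (intro ln_mono) auto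
      then have "ln (mat_labs A) \<le> - ln (labs (x $ 2)) / (m - 1)"
        using m unfolding ln_exp by (subst pos_le_divide_eq) (auto simp: algebra_simps)
      then have "exp (ln (mat_labs A)) \<le> exp (- ln (labs (x $ 2)) / (m - 1))" by simp
      then show "mat_labs A \<le> exp (- ln (labs (x $ 2)) / (m - 1))" using A1 by simp
    qed
  qed
next
  obtain c where c: "\<And>k. \<exists>A\<in>SL2. act A x \<noteq> 0 \<and> mat_labs A \<le> exp (c + n (Suc k))
     \<and> vec_labs (act A x - 0) \<le> exp (- (n (Suc k) - c))"
    using convergent_matrix by blast
  have *: "ereal m \<le> mu x 0" if m: "0 < m" "m < 1" for m
  proof (rule le_mu[OF m(1)])
    fix G
    have n1: "filterlim (\<lambda>k. n (Suc k)) at_top sequentially"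
      using n_Suc_at_top[of 1] by simp
    have "\<forall>\<^sub>F k in sequentially. m * n (Suc k) + (m * c + c) \<le> 1 * n (Suc k)"
      using eventually_linear_le[OF n1 m(2)] .
    moreover have "\<forall>\<^sub>F k in sequentially. n (Suc k) \<ge> G + c"
      using n1 by (simp add: filterlim_at_top)
    ultimately have "\<forall>\<^sub>F k in sequentially. m * (c + n (Suc k)) \<le> n (Suc k) - c \<and> n (Suc k) - c \<ge> G"
      by eventually_elim (auto simp: algebra_simps)
    then obtain k where "m * (c + n (Suc k)) \<le> n (Suc k) - c" "n (Suc k) - c \<ge> G"
      by (auto simp: eventually_sequentially)
    then show "\<exists>A\<in>SL2. \<exists>f g. g \<ge> G \<and> m * f \<le> g \<and> act A x \<noteq> 0
      \<and> mat_labs A \<le> exp f \<and> vec_labs (act A x - 0) \<le> exp (- g)"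
      using c[of k] by blast
  qed
  have "0 \<le> mu x 0" using *[of "1/2"] by (auto intro: order_trans[rotated])
  then show "1 \<le> mu x 0"
    by (rule le_ereal_positive_dense) (use * in \<open>auto simp: one_ereal_def\<close>)
qed

text \<open>Upper bound: just below height \<open>N (Suc k)\<close>, with
  \<open>n (Suc k) \<ge> w * n k\<close>, both rows would be multiples of one convergent and the
  determinant would vanish. Lower bound: consecutive heights of \<open>convergent_matrix\<close>
  eventually grow by at most the exponent \<open>w\<close>.\<close>

theorem mu_hat_zero: "mu_hat x 0 = 1 / irrationality_exponent \<xi>"
proof (rule antisym)
  show "mu_hat x 0 \<le> 1 / irrationality_exponent \<xi>"
  proof (rule mu_hat_le)
    fix m assume "1 / irrationality_exponent \<xi> < ereal m"
    then obtain w where w: "w > 0" "ereal w < irrationality_exponent \<xi>" "1 < m * w"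
      using ereal_one_divide_less[OF irrationality_exponent_ge_1] by blast
    have m: "m > 0" using w by (smt (verit) mult_nonneg_nonneg mult_nonpos_nonneg)
    show "\<exists>\<^sub>F H in at_top. \<not> (\<exists>A\<in>SL2. mat_labs A \<le> H \<and> vec_labs (act A x - 0) \<le> H powr (- m))"
    proof (rule ccontr)
      assume "\<not> ?thesis"
      then have ev: "\<forall>\<^sub>F H in at_top. \<exists>A\<in>SL2. mat_labs A \<le> H \<and> vec_labs (act A x - 0) \<le> H powr (- m)"
        by (simp add: frequently_def)
      \<comment> \<open>Half of \<open>N (Suc k)\<close>, so that entries of this size times
        \<open>eps k\<close> stay strictly below 1.\<close>
      define h where "h k = n (Suc k) - ln 2" for k
      have "filterlim h at_top sequentially"
        using filterlim_tendsto_add_at_top[OF tendsto_const[of "- ln 2"] n_Suc_at_top[of 1]]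
        unfolding h_def by simp
      then have "filterlim (\<lambda>k. exp (h k)) at_top sequentially"
        by (rule filterlim_compose[OF exp_at_top])
      then have "\<forall>\<^sub>F k in sequentially. \<exists>A\<in>SL2. mat_labs A \<le> exp (h k)
          \<and> vec_labs (act A x - 0) \<le> exp (h k) powr (- m)"
        using ev by (rule eventually_compose_filterlim[rotated])
      moreover have "\<forall>\<^sub>F k in sequentially. 1 * n k + (m * ln 2 - ln (labs (x $ 2)) + 1) \<le> (m * w) * n k"
        by (rule eventually_linear_le[OF n_at_top w(3)])
      ultimately have "\<forall>\<^sub>F k in sequentially. (\<exists>A\<in>SL2. mat_labs A \<le> exp (h k)
          \<and> vec_labs (act A x - 0) \<le> exp (h k) powr (- m))
          \<and> 1 * n k + (m * ln 2 - ln (labs (x $ 2)) + 1) \<le> (m * w) * n k"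
        by (rule eventually_conj)
      from frequently_eventually_conj[OF frequently_n_Suc_ge[OF w(2,1)] this]
      obtain k A where k: "w * n k \<le> n (Suc k)"
        "1 * n k + (m * ln 2 - ln (labs (x $ 2)) + 1) \<le> (m * w) * n k"
        and A: "A \<in> SL2" "mat_labs A \<le> exp (h k)" "vec_labs (act A x - 0) \<le> exp (h k) powr (- m)"
        by (auto dest!: frequently_ex)
      have "m * (w * n k) \<le> m * n (Suc k)" using k(1) m by simp
      \<comment> \<open>The exponential of the left side will bound \<open>N k\<close> times the
        linear form of each row.\<close>
      then have lt: "n k - m * h k - ln (labs (x $ 2)) < 0"
        using k(2) by (simp add: h_def algebra_simps)
      have row: "\<exists>c. A $ i $ 1 = c * Q k \<and> A $ i $ 2 = c * R k" for i
      proof (rule proportional_to_convergent)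
        have "pabs (A $ i $ 1) \<le> exp (h k)"
          using A(2) exhaust_2[of i] by (auto simp: mat_labs_le_iff)
        also have "\<dots> = N (Suc k) / 2" using N_pos[of "Suc k"] by (simp add: h_def exp_diff exp_n)
        also have "\<dots> < N (Suc k)" using N_pos[of "Suc k"] by simp
        finally show "labs (poly_T (A $ i $ 1) * eps k) < 1"
          using N_pos[of "Suc k"] by (simp add: labs_mult labs_eps)
        have "labs (act A x $ i) \<le> exp (h k) powr (- m)"
          using A(3) exhaust_2[of i] by (auto simp: vec_labs_le_iff)
        then have "labs (x $ 2) * labs (poly_T (A $ i $ 1) * \<xi> + poly_T (A $ i $ 2)) \<le> exp (- (m * h k))"
          by (simp add: act_nth_slope labs_mult powr_minus_eq_exp)
        then have "labs (poly_T (A $ i $ 1) * \<xi> + poly_T (A $ i $ 2)) \<le> exp (- (m * h k)) / labs (x $ 2)"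
          using x2 by (simp add: field_simps)
        then have "N k * labs (poly_T (A $ i $ 1) * \<xi> + poly_T (A $ i $ 2))
            \<le> N k * (exp (- (m * h k)) / labs (x $ 2))"
          by (intro mult_left_mono) auto
        also have "\<dots> = exp (n k - m * h k - ln (labs (x $ 2)))"
          using x2 by (simp add: exp_diff exp_n exp_minus divide_inverse)
        also have "\<dots> < 1" using lt by simp
        finally show "labs (poly_T (Q k) * (poly_T (A $ i $ 1) * \<xi> + poly_T (A $ i $ 2))) < 1"
          by (simp add: labs_mult)
      qed
      obtain a b where "A $ 1 $ 1 = a * Q k" "A $ 1 $ 2 = a * R k" "A $ 2 $ 1 = b * Q k" "A $ 2 $ 2 = b * R k"
        using row[of 1] row[of 2] by blast
      then have "A $ 1 $ 1 * A $ 2 $ 2 - A $ 1 $ 2 * A $ 2 $ 1 = 0" by (simp add: algebra_simps)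
      then show False using A(1) by (simp add: SL2_iff)
    qed
  qed
next
  obtain c where c: "\<And>k. \<exists>A\<in>SL2. act A x \<noteq> 0 \<and> mat_labs A \<le> exp (c + n (Suc k))
     \<and> vec_labs (act A x - 0) \<le> exp (- (n (Suc k) - c))"
    using convergent_matrix by blast
  show "1 / irrationality_exponent \<xi> \<le> mu_hat x 0"
  proof (rule le_ereal_positive_dense[OF mu_hat_nonneg])
    fix m assume m: "m > 0" "ereal m < 1 / irrationality_exponent \<xi>"
    obtain w where w: "w > 0" "irrationality_exponent \<xi> < ereal w" "m * w < 1"
      using ereal_less_one_divide[OF irrationality_exponent_ge_1 m] by blast
    have n1: "filterlim (\<lambda>k. n (Suc k)) at_top sequentially"
      using n_Suc_at_top[of 1] by simp
    show "ereal m \<le> mu_hat x 0"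
    proof (rule le_mu_hat[OF m(1), where f = "\<lambda>k. c + n (Suc k)" and g = "\<lambda>k. n (Suc k) - c"])
      show "filterlim (\<lambda>k. c + n (Suc k)) at_top sequentially"
        by (rule filterlim_tendsto_add_at_top[OF tendsto_const n1])
      show "\<forall>\<^sub>F k in sequentially. \<exists>A\<in>SL2. mat_labs A \<le> exp (c + n (Suc k))
          \<and> vec_labs (act A x - 0) \<le> exp (- (n (Suc k) - c))"
        using c by (intro always_eventually) blast
      have "\<forall>\<^sub>F k in sequentially. n (Suc (Suc k)) \<le> w * n (Suc k)"
        using eventually_n_Suc_le[OF w(2)] by (subst eventually_sequentially_Suc)
      moreover have "\<forall>\<^sub>F k in sequentially. (m * w) * n (Suc k) + (m * c + c) \<le> 1 * n (Suc k)"
        by (rule eventually_linear_le[OF n1 w(3)])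
      ultimately show "\<forall>\<^sub>F k in sequentially. m * (c + n (Suc (Suc k))) \<le> n (Suc k) - c"
      proof eventually_elim
        case (elim k)
        have "m * n (Suc (Suc k)) \<le> m * (w * n (Suc k))" using elim(1) m(1) by simp
        then show ?case using elim(2) by (simp add: algebra_simps)
      qed
    qed
  qed
qed

text \<open>The indices \<open>j\<close> and \<open>k\<close> are balanced so that both error
  exponents in \<open>irrational_target\<close> are at least a third of the height exponent, up to
  constants.\<close>

theorem mu_irrational_slope:
  fixes y :: "'a fls ^ 2"
  assumes conv: "convergents \<eta> Q' R'" and y: "y $ 2 \<noteq> 0" "y $ 1 = \<eta> * y $ 2"
  shows "1 / 3 \<le> mu x y"
proof -
  interpret y: convergents \<eta> Q' R' by (rule conv)
  obtain c where c: "\<And>j k. \<exists>A\<in>SL2. act A x \<noteq> y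
    \<and> mat_labs A \<le> exp (c + n (Suc (Suc k)) + max (y.n (Suc j)) (n (Suc k)))
    \<and> vec_labs (act A x - y) \<le> exp (- (min (n (Suc (Suc k)) - y.n (Suc j))
        (y.n (Suc j) + y.n (Suc (Suc j))) - c))"
    using irrational_target[OF assms] by blast
  have n1: "filterlim (\<lambda>k. n (Suc k)) at_top sequentially"
    using n_Suc_at_top[of 1] by simp
  have y1: "filterlim (\<lambda>k. y.n (Suc k)) at_top sequentially"
    using y.n_Suc_at_top[of 1] by simp
  then have y3: "filterlim (\<lambda>j. 3 * y.n (Suc j)) at_top sequentially"
    by (intro filterlim_tendsto_pos_mult_at_top[OF tendsto_const]) auto
  have *: "ereal m \<le> mu x y" if m: "0 < m" "m < 1 / 3" for m
  proof (rule le_mu[OF m(1)])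
    fix G
    \<comment> \<open>Three demands: \<open>g \<ge> G\<close>, absorption of the constants in
      \<open>m * f \<le> 3 * m * g + 4 * m * c\<close>, and a starting point for the crossing
      argument.\<close>
    define T where "T = max (max G (4 * m * c / (1 - 3 * m)) + c) (n (Suc 0))"
    have "\<forall>\<^sub>F j in sequentially. y.n (Suc j) \<ge> T"
      using y1 by (simp add: filterlim_at_top)
    then obtain J where J: "\<And>j. j \<ge> J \<Longrightarrow> y.n (Suc j) \<ge> T"
      by (auto simp: eventually_sequentially)
    \<comment> \<open>First \<open>k\<close> is chosen so that a cube of a denominator of the slope of \<open>y\<close> lies between
      two denominators of \<open>\<xi>\<close>; the largest such cube then makes both error terms at most the
      inverse cube root of the height.\<close>
    have "n (Suc 0) \<le> 3 * y.n (Suc J)"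
      using J[of J] n_nonneg[of "Suc 0"] by (simp add: T_def)
    from filterlim_at_top_crossing[OF n1 this] obtain k
      where k: "n (Suc k) \<le> 3 * y.n (Suc J)" "3 * y.n (Suc J) < n (Suc (Suc k))" by blast
    from filterlim_at_top_crossing[OF y3 less_imp_le[OF k(2)]] obtain j
      where j: "j \<ge> J" "3 * y.n (Suc j) \<le> n (Suc (Suc k))" "n (Suc (Suc k)) < 3 * y.n (Suc (Suc j))"
      by blast
    define s s' z X where defs: "s = y.n (Suc j)" "s' = y.n (Suc (Suc j))"
      "z = n (Suc k)" "X = n (Suc (Suc k))"
    have "y.n (Suc J) \<le> s" using y.n_mono[of "Suc J" "Suc j"] j by (simp add: defs)
    then have ineqs: "z \<le> 3 * s" "3 * s \<le> X" "X \<le> 3 * s'" "T \<le> s" "s \<ge> 0" "s' \<ge> 0"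
      using k j J[of j] y.n_nonneg[of "Suc j"] y.n_nonneg[of "Suc (Suc j)"]
      unfolding defs[symmetric] by linarith+
    define f g where "f = c + X + max s z" and "g = min (X - s) (s + s') - c"
    \<comment> \<open>\<open>max s z \<le> 3 s \<le> X\<close> makes \<open>X + max s z\<close> at
      most \<open>2 X \<le> 3 (X - s)\<close>, and \<open>X \<le> 3 s'\<close> makes it at most
      \<open>3 (s + s')\<close>.\<close>
    have fg: "f - c \<le> 3 * (g + c)" using ineqs by (auto simp: f_def g_def min_def max_def)
    have g: "g \<ge> s - c" using ineqs by (simp add: g_def)
    have "max G (4 * m * c / (1 - 3 * m)) + c \<le> T" unfolding T_def by (rule max.cobounded1)
    then have gT: "g \<ge> max G (4 * m * c / (1 - 3 * m))" using g ineqs(4) by linarith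
    then have "4 * m * c / (1 - 3 * m) \<le> g" by simp
    then have "4 * m * c \<le> g * (1 - 3 * m)" using m by (subst (asm) pos_divide_le_eq) auto
    moreover have "m * f \<le> m * (3 * g + 4 * c)" using fg m by (intro mult_left_mono) auto
    ultimately have "m * f \<le> g" by (simp add: algebra_simps)
    then show "\<exists>A\<in>SL2. \<exists>f g. g \<ge> G \<and> m * f \<le> g \<and> act A x \<noteq> y
      \<and> mat_labs A \<le> exp f \<and> vec_labs (act A x - y) \<le> exp (- g)"
      using c[of k j] gT unfolding defs[symmetric] f_def[symmetric] g_def[symmetric]
      by (meson max.bounded_iff)
  qed
  have third: "(1 / 3 :: ereal) = ereal (1 / 3)" by (simp add: one_ereal_def)
  have "0 \<le> mu x y" using *[of "1/4"] by (auto intro: order_trans[rotated])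
  then have "ereal (1 / 3) \<le> mu x y"
    by (rule le_ereal_positive_dense) (use * in \<open>simp only: less_ereal.simps\<close>)
  then show ?thesis by (simp only: third)
qed

text \<open>Both competing denominators are at most \<open>N (k + 2)\<close>, so the height exponent
  is at most \<open>2 * n (k + 2)\<close> up to a constant, the source of the factor 2. The error
  exponent is \<open>\<beta> * n (k + 2)\<close>, and lasting until the next height costs the factor
  \<open>w\<close>.\<close>

theorem mu_hat_irrational_slope:
  fixes y :: "'a fls ^ 2"
  assumes conv: "convergents \<eta> Q' R'" and y: "y $ 2 \<noteq> 0" "y $ 1 = \<eta> * y $ 2"
  shows "irrational_slope_mu_hat_bound (irrationality_exponent \<xi>) (irrationality_exponent \<eta>)
    \<le> mu_hat x y"
proof (rule le_ereal_positive_dense[OF mu_hat_nonneg])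
  interpret y: convergents \<eta> Q' R' by (rule conv)
  fix m
  assume m: "m > 0" "ereal m < irrational_slope_mu_hat_bound (irrationality_exponent \<xi>) (irrationality_exponent \<eta>)"
  obtain w \<beta> where w: "irrationality_exponent \<xi> < ereal w" "0 < w" "2 * m * w < \<beta>"
    and \<beta>: "\<beta> = 1 / 2 \<or> (\<exists>v>0. irrationality_exponent \<eta> < ereal v \<and> \<beta> = (v + 1) / (2 * v + 1))"
    using ereal_less_irrational_slope_bound[OF irrationality_exponent_ge_1 y.irrationality_exponent_ge_1 m]
    by blast
  have \<beta>0: "\<beta> > 0" using w m by (smt (verit) mult_pos_pos)
  obtain c where c: "\<And>j k. \<exists>A\<in>SL2. act A x \<noteq> y
    \<and> mat_labs A \<le> exp (c + n (Suc (Suc k)) + max (y.n (Suc j)) (n (Suc k)))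
    \<and> vec_labs (act A x - y) \<le> exp (- (min (n (Suc (Suc k)) - y.n (Suc j))
        (y.n (Suc j) + y.n (Suc (Suc j))) - c))"
    using irrational_target[OF assms] by blast
  have n2: "filterlim (\<lambda>k. n (Suc (Suc k))) at_top sequentially"
    using n_Suc_at_top[of 2] by simp
  show "ereal m \<le> mu_hat x y"
  proof (rule le_mu_hat[OF m(1), where f = "\<lambda>k. c + 2 * n (Suc (Suc k))"
        and g = "\<lambda>k. \<beta> * n (Suc (Suc k)) - c"])
    show "filterlim (\<lambda>k. c + 2 * n (Suc (Suc k))) at_top sequentially"
      by (intro filterlim_tendsto_add_at_top[OF tendsto_const]
          filterlim_tendsto_pos_mult_at_top[OF tendsto_const _ n2]) auto
    have "\<forall>\<^sub>F k in sequentially. \<exists>j. y.n (Suc j) \<le> (1 - \<beta>) * n (Suc (Suc k))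
        \<and> \<beta> * n (Suc (Suc k)) \<le> y.n (Suc j) + y.n (Suc (Suc j))"
      using y.window[OF \<beta>] n2 by (rule eventually_compose_filterlim)
    then show "\<forall>\<^sub>F k in sequentially. \<exists>A\<in>SL2. mat_labs A \<le> exp (c + 2 * n (Suc (Suc k)))
        \<and> vec_labs (act A x - y) \<le> exp (- (\<beta> * n (Suc (Suc k)) - c))"
    proof eventually_elim
      case (elim k)
      then obtain j where j: "y.n (Suc j) \<le> (1 - \<beta>) * n (Suc (Suc k))"
        "\<beta> * n (Suc (Suc k)) \<le> y.n (Suc j) + y.n (Suc (Suc j))" by blast
      obtain A where A: "A \<in> SL2"
        "mat_labs A \<le> exp (c + n (Suc (Suc k)) + max (y.n (Suc j)) (n (Suc k)))"
        "vec_labs (act A x - y) \<le> exp (- (min (n (Suc (Suc k)) - y.n (Suc j))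
          (y.n (Suc j) + y.n (Suc (Suc j))) - c))"
        using c[of k j] by blast
      have "0 \<le> \<beta> * n (Suc (Suc k))" using \<beta>0 n_nonneg by simp
      then have le: "y.n (Suc j) \<le> n (Suc (Suc k))" "\<beta> * n (Suc (Suc k)) \<le> n (Suc (Suc k)) - y.n (Suc j)"
        using j(1) by (simp_all add: algebra_simps)
      have "exp (c + n (Suc (Suc k)) + max (y.n (Suc j)) (n (Suc k))) \<le> exp (c + 2 * n (Suc (Suc k)))"
        unfolding exp_le_cancel_iff using le(1) n_less[of "Suc k"] by linarith
      moreover have "exp (- (min (n (Suc (Suc k)) - y.n (Suc j)) (y.n (Suc j) + y.n (Suc (Suc j))) - c))
          \<le> exp (- (\<beta> * n (Suc (Suc k)) - c))"
        unfolding exp_le_cancel_iff using le(2) j(2) by linarith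
      ultimately show ?case using A by (intro bexI[of _ A] conjI) linarith+
    qed
    have "\<forall>\<^sub>F k in sequentially. n (Suc (Suc (Suc k))) \<le> w * n (Suc (Suc k))"
      using eventually_n_Suc_le[OF w(1)]
      by (subst eventually_sequentially_Suc[of "\<lambda>k. n (Suc (Suc k)) \<le> w * n (Suc k)"],
          subst eventually_sequentially_Suc)
    moreover have "\<forall>\<^sub>F k in sequentially. (2 * m * w) * n (Suc (Suc k)) + (m * c + c) \<le> \<beta> * n (Suc (Suc k))"
      by (rule eventually_linear_le[OF n2 w(3)])
    ultimately show "\<forall>\<^sub>F k in sequentially. m * (c + 2 * n (Suc (Suc (Suc k)))) \<le> \<beta> * n (Suc (Suc k)) - c"
    proof eventually_elim
      case (elim k)
      have "m * n (Suc (Suc (Suc k))) \<le> m * (w * n (Suc (Suc k)))" using elim(1) m(1) by simp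
      then show ?case using elim(2) by (simp add: algebra_simps)
    qed
  qed
qed

end

section \<open>Targets of rational slope\<close>

context convergents_vector
begin

text \<open>The inverse of the matrix with columns \<open>(p, s)\<close>, \<open>(p', s')\<close>
  moves \<open>y\<close> to \<open>(\<theta>, 0)\<close>. After division by \<open>x $ 2\<close> the
  coordinates become the linear forms of the new rows, and norms change by at most a constant
  factor.\<close>

lemma rational_target_coordinates:
  fixes y :: "'a fls ^ 2"
  assumes d: "p * s' - p' * s = 1"
    and y: "y $ 1 = \<theta> * poly_T p" "y $ 2 = \<theta> * poly_T s"
  shows "\<exists>C\<ge>1. \<forall>A\<in>SL2. \<exists>a b c d. a * d - b * c = 1 \<and> pabs a \<le> C * mat_labs A
    \<and> labs (poly_T a * \<xi> + poly_T b - \<theta> / x $ 2) \<le> C * vec_labs (act A x - y)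
    \<and> labs (poly_T c * \<xi> + poly_T d) \<le> C * vec_labs (act A x - y)"
proof -
  define M where "M = max (max (pabs p) (pabs p')) (max (pabs s) (pabs s'))"
  have M: "pabs p \<le> M" "pabs (- p') \<le> M" "pabs (- s) \<le> M" "pabs s' \<le> M"
    by (auto simp: M_def poly_T_uminus)
  define C where "C = max 1 (max M (M / labs (x $ 2)))"
  have C: "C \<ge> 1" "M \<le> C" "M / labs (x $ 2) \<le> C" by (auto simp: C_def)
  have "\<exists>a b c d. a * d - b * c = 1 \<and> pabs a \<le> C * mat_labs A
    \<and> labs (poly_T a * \<xi> + poly_T b - \<theta> / x $ 2) \<le> C * vec_labs (act A x - y)
    \<and> labs (poly_T c * \<xi> + poly_T d) \<le> C * vec_labs (act A x - y)"
    if A: "A \<in> SL2" for A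
  proof -
    define V where "V = vec_labs (act A x - y)"
    define E1 E2 where "E1 = act A x $ 1 - y $ 1" and "E2 = act A x $ 2 - y $ 2"
    have E: "labs E1 \<le> V" "labs E2 \<le> V"
      using vec_labs_le_iff[of "act A x - y" V] by (auto simp: V_def E1_def E2_def)
    have V0: "V \<ge> 0" by (simp add: V_def vec_labs_nonneg)
    have A0: "mat_labs A \<ge> 0" using SL2_mat_labs_ge_1[OF A] by simp
    have scale: "labs z \<le> C * V" if "labs (x $ 2 * z) \<le> M * V" for z
    proof -
      have "labs z \<le> M / labs (x $ 2) * V"
        using that x2 by (simp add: labs_mult field_simps)
      also have "\<dots> \<le> C * V" using C V0 by (intro mult_right_mono)
      finally show ?thesis .
    qed
    define a b c d where "a = s' * A $ 1 $ 1 + (- p') * A $ 2 $ 1" and "b = s' * A $ 1 $ 2 + (- p') * A $ 2 $ 2"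
      and "c = (- s) * A $ 1 $ 1 + p * A $ 2 $ 1" and "d = (- s) * A $ 1 $ 2 + p * A $ 2 $ 2"
    note defs = a_def b_def c_def d_def
    have "a * d - b * c = (p * s' - p' * s) * (A $ 1 $ 1 * A $ 2 $ 2 - A $ 1 $ 2 * A $ 2 $ 1)"
      by (simp add: defs algebra_simps)
    then have 1: "a * d - b * c = 1" using d A by (simp add: SL2_iff)
    have "pabs a \<le> M * mat_labs A"
      unfolding a_def poly_T_add poly_T_mult using M mat_labs_le_iff[of A "mat_labs A"]
      by (intro labs_lincomb_le) auto
    also have "\<dots> \<le> C * mat_labs A" using C A0 by (intro mult_right_mono)
    finally have 2: "pabs a \<le> C * mat_labs A" .
    have "poly_T s' * y $ 1 - poly_T p' * y $ 2 = \<theta> * poly_T (p * s' - p' * s)"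
      by (simp add: y poly_T_hom algebra_simps)
    then have \<theta>: "poly_T s' * y $ 1 - poly_T p' * y $ 2 = \<theta>" using d by simp
    have "x $ 2 * (poly_T a * \<xi> + poly_T b - \<theta> / x $ 2)
        = poly_T s' * act A x $ 1 - poly_T p' * act A x $ 2 - \<theta>"
      using x2 by (simp add: act_nth_slope defs poly_T_hom algebra_simps)
    also have "\<dots> = poly_T s' * E1 + poly_T (- p') * E2"
      by (subst \<theta>[symmetric]) (simp add: E1_def E2_def poly_T_hom algebra_simps)
    finally have 3: "labs (x $ 2 * (poly_T a * \<xi> + poly_T b - \<theta> / x $ 2)) \<le> M * V"
      using M E by (auto intro!: labs_lincomb_le)
    have "x $ 2 * (poly_T c * \<xi> + poly_T d) = poly_T (- s) * E1 + poly_T p * E2"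
      by (simp add: act_nth_slope E1_def E2_def y defs poly_T_hom algebra_simps)
    then have 4: "labs (x $ 2 * (poly_T c * \<xi> + poly_T d)) \<le> M * V"
      using M E by (auto intro!: labs_lincomb_le)
    show ?thesis using 1 2 scale[OF 3] scale[OF 4] unfolding V_def by blast
  qed
  then show ?thesis using C(1) by blast
qed

text \<open>The products of \<open>a\<close> with the second form and of \<open>c\<close> with the
  first differ by the determinant 1, and the first form has absolute value \<open>labs L\<close>.
  Once one product exceeds 1, both have equal absolute value. With \<open>c = 0\<close> the
  polynomial \<open>d\<close> would be below 1, hence zero.\<close>

lemma unimodular_near_axis:
  assumes d: "a * d - b * c = (1 :: 'a poly)"
    and near: "labs (poly_T a * \<xi> + poly_T b - L) < labs L" "labs (poly_T c * \<xi> + poly_T d) < 1"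
  shows "c \<noteq> 0"
    and "pabs c * labs L \<le> max 1 (pabs a * labs (poly_T c * \<xi> + poly_T d))"
    and "1 < pabs c * labs L \<Longrightarrow> pabs a * labs (poly_T c * \<xi> + poly_T d) = pabs c * labs L"
proof -
  show "c \<noteq> 0"
  proof
    assume "c = 0"
    then have "d = 0" using near(2) by (simp add: pabs_less_1_iff)
    then show False using d \<open>c = 0\<close> by simp
  qed
  have "labs (poly_T a * \<xi> + poly_T b) = labs L"
    using labs_add_eq[OF near(1)] by simp
  then have c: "labs (poly_T c * (poly_T a * \<xi> + poly_T b)) = pabs c * labs L"
    by (simp add: labs_mult)
  have "poly_T a * (poly_T c * \<xi> + poly_T d) - poly_T c * (poly_T a * \<xi> + poly_T b)
      = poly_T (a * d - b * c)"
    by (simp add: poly_T_hom algebra_simps)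
  then have eq: "poly_T a * (poly_T c * \<xi> + poly_T d) = poly_T c * (poly_T a * \<xi> + poly_T b) + 1"
    by (simp add: d algebra_simps)
  then have "labs (poly_T a * (poly_T c * \<xi> + poly_T d) - 1) = pabs c * labs L"
    by (simp add: c)
  then show "pabs c * labs L \<le> max 1 (pabs a * labs (poly_T c * \<xi> + poly_T d))"
    using labs_diff_le[of "poly_T a * (poly_T c * \<xi> + poly_T d)" 1]
    by (simp only: labs_mult labs_1 max.commute)
  assume "1 < pabs c * labs L"
  then have "labs 1 < labs (poly_T c * (poly_T a * \<xi> + poly_T b))"
    by (simp only: c labs_1)
  from labs_add_eq[OF this]
  have "labs (poly_T a * (poly_T c * \<xi> + poly_T d)) = pabs c * labs L"
    by (simp only: eq c)
  then show "pabs a * labs (poly_T c * \<xi> + poly_T d) = pabs c * labs L"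
    by (simp only: labs_mult)
qed

text \<open>Upper bound: \<open>pabs a * labs l = pabs c * labs L\<close>, where a small form
  \<open>l\<close> forces \<open>pabs c\<close> to be at least \<open>labs l\<close> to the power
  \<open>- \<kappa>\<close>; so \<open>a\<close> has at least order of the error to the power
  \<open>- (1 + \<kappa>)\<close>. Lower bound: \<open>rational_target\<close> at indices where the
  denominators grow by the exponent \<open>w\<close>.\<close>

theorem mu_rational_slope:
  fixes y :: "'a fls ^ 2"
  assumes d: "p * s' - p' * s = 1"
    and y: "y $ 1 = \<theta> * poly_T p" "y $ 2 = \<theta> * poly_T s" and \<theta>: "\<theta> \<noteq> 0"
  shows "mu x y = rational_slope_mu (irrationality_exponent \<xi>)"
proof (rule antisym)
  show "mu x y \<le> rational_slope_mu (irrationality_exponent \<xi>)"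
  proof (rule mu_le)
    fix m assume "rational_slope_mu (irrationality_exponent \<xi>) < ereal m"
    then obtain \<kappa> where m: "m > 0" and \<kappa>: "\<kappa> \<ge> 0" "1 < m * (1 + \<kappa>)"
      "\<kappa> = 0 \<or> irrationality_exponent \<xi> < ereal (1 / \<kappa>)"
      using rational_slope_mu_less_ereal[OF irrationality_exponent_ge_1] by blast
    define L where "L = \<theta> / x $ 2"
    have L: "labs L > 0" using \<theta> x2 by (simp add: L_def)
    have "\<forall>\<^sub>F k in sequentially. \<kappa> * n (Suc k) \<le> n k"
      using \<kappa>(3)
    proof
      assume "irrationality_exponent \<xi> < ereal (1 / \<kappa>)"
      from eventually_n_Suc_le[OF this] show ?thesis
      proof eventually_elim
        case (elim k)
        show ?case
        proof (cases "\<kappa> = 0")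
          case False
          then show ?thesis using elim \<kappa>(1) by (simp add: field_simps)
        qed (use n_nonneg in simp)
      qed
    qed (use n_nonneg in simp)
    moreover have "\<forall>\<^sub>F k in sequentially. n k > - ln (labs L)"
      using n_at_top by (simp add: filterlim_at_top_dense)
    ultimately have "\<forall>\<^sub>F k in sequentially. \<kappa> * n (Suc k) \<le> n k \<and> n k > - ln (labs L)"
      by (rule eventually_conj)
    then obtain K where K: "\<And>k. k \<ge> K \<Longrightarrow> \<kappa> * n (Suc k) \<le> n k \<and> n k > - ln (labs L)"
      by (auto simp: eventually_sequentially)
    obtain e1 where e1: "e1 > 0" "\<And>c d. c \<noteq> 0 \<Longrightarrow> labs (poly_T c * \<xi> + poly_T d) < e1 \<Longrightarrow>
       (\<exists>k\<ge>K. n k \<le> ln (pabs c) \<and> - ln (labs (poly_T c * \<xi> + poly_T d)) \<le> n (Suc k))"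
      using linear_form_small[of K] by blast
    obtain C where C: "C \<ge> 1" "\<And>A. A \<in> SL2 \<Longrightarrow> \<exists>a b c d. a * d - b * c = 1
      \<and> pabs a \<le> C * mat_labs A
      \<and> labs (poly_T a * \<xi> + poly_T b - L) \<le> C * vec_labs (act A x - y)
      \<and> labs (poly_T c * \<xi> + poly_T d) \<le> C * vec_labs (act A x - y)"
      using rational_target_coordinates[OF d y] unfolding L_def by blast
    \<comment> \<open>Below \<open>e1\<close> the form yields an index \<open>k \<ge> K\<close>;
      below 1 and \<open>labs L\<close> the rows satisfy
      \<open>unimodular_near_axis\<close>.\<close>
    define e2 where "e2 = min e1 (min 1 (labs L))"
    have e2: "e2 > 0" using e1 L by (simp add: e2_def)
    \<comment> \<open>Beyond \<open>G1\<close> the error is below \<open>e2\<close>;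
      \<open>G2\<close> is the solution for \<open>g\<close> of the inequality reached at the
      end.\<close>
    define G1 where "G1 = (ln C - ln e2) / m"
    define G2 where "G2 = ((2 + \<kappa>) * ln C - ln (labs L)) / (m * (1 + \<kappa>) - 1)"
    show "\<exists>G. \<forall>A\<in>SL2. vec_labs (act A x - y) \<le> mat_labs A powr (- m) \<longrightarrow> mat_labs A \<le> G"
    proof (intro exI ballI impI)
      fix A assume A: "A \<in> SL2" and small: "vec_labs (act A x - y) \<le> mat_labs A powr (- m)"
      have A1: "mat_labs A \<ge> 1" using A by (rule SL2_mat_labs_ge_1)
      define g where "g = ln (mat_labs A)"
      have "C * vec_labs (act A x - y) \<le> C * exp (- (m * g))"
        using small A1 C(1) unfolding g_def by (simp add: powr_minus_eq_exp)
      also have "\<dots> = exp (ln C - m * g)" using C(1) by (simp add: exp_diff exp_minus divide_inverse)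
      finally have err: "C * vec_labs (act A x - y) \<le> exp (ln C - m * g)" .
      have "g \<le> max G1 G2"
      proof (rule ccontr)
        assume "\<not> g \<le> max G1 G2"
        then have g: "G1 < g" "G2 < g" by auto
        have "ln C - m * g < ln e2" using g(1) m by (simp add: G1_def field_simps)
        then have "exp (ln C - m * g) < e2" using e2 by (metis exp_less_cancel_iff exp_ln)
        then have err2: "exp (ln C - m * g) < e1" "exp (ln C - m * g) < 1" "exp (ln C - m * g) < labs L"
          unfolding e2_def by auto
        obtain a b c d where abcd: "a * d - b * c = 1" "pabs a \<le> C * mat_labs A"
          "labs (poly_T a * \<xi> + poly_T b - L) \<le> exp (ln C - m * g)"
          "labs (poly_T c * \<xi> + poly_T d) \<le> exp (ln C - m * g)"
          using C(2)[OF A] err by (meson order_trans)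
        define l where "l = poly_T c * \<xi> + poly_T d"
        have near: "labs (poly_T a * \<xi> + poly_T b - L) < labs L" "labs l < 1"
          using abcd err2 unfolding l_def by linarith+
        note ax = unimodular_near_axis[OF abcd(1) near[unfolded l_def], folded l_def]
        have c0: "c \<noteq> 0" by (rule ax(1))
        have "labs l < e1" using abcd err2 unfolding l_def by linarith
        then obtain k where k: "k \<ge> K" "n k \<le> ln (pabs c)" "- ln (labs l) \<le> n (Suc k)"
          using e1(2)[OF c0] unfolding l_def by blast
        have l0: "labs l > 0" unfolding l_def using linear_form_nonzero[OF irrational] c0 by simp
        have pc: "pabs c > 0" using c0 by simp
        have "- ln (labs L) < ln (pabs c)" using K[OF k(1)] k(2) by linarith
        then have "0 < ln (pabs c * labs L)" using pc L by (simp add: ln_mult)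
        then have eq: "pabs a * labs l = pabs c * labs L"
          using pc L ax(3) by (simp add: ln_gt_zero_iff)
        then have pa: "pabs a > 0" using pc L l0 by (metis mult_pos_pos zero_less_mult_pos2)
        have "ln (pabs a) + ln (labs l) = ln (pabs c) + ln (labs L)"
          using arg_cong[OF eq, of ln] pa l0 pc L by (simp add: ln_mult)
        moreover have "ln (pabs a) \<le> ln (C * mat_labs A)"
          using abcd(2) pa by (intro ln_mono) auto
        then have "ln (pabs a) \<le> ln C + g"
          using C(1) A1 by (simp add: ln_mult g_def)
        moreover have "ln (labs l) \<le> ln (exp (ln C - m * g))"
          using abcd(4) l0 unfolding l_def by (intro ln_mono) auto
        then have le: "m * g - ln C \<le> - ln (labs l)" by simp
        moreover have "\<kappa> * (- ln (labs l)) \<le> ln (pabs c)"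
          using mult_left_mono[OF k(3) \<kappa>(1)] K[OF k(1)] k(2) by linarith
        moreover have "\<kappa> * (m * g - ln C) \<le> \<kappa> * (- ln (labs l))"
          using le \<kappa>(1) by (rule mult_left_mono)
        \<comment> \<open>The terms on the left bound \<open>- ln (labs l)\<close> and
          \<open>ln (pabs c)\<close> from below, the right side bounds \<open>ln (pabs a)\<close>
          from above.\<close>
        ultimately have "(m * g - ln C) + \<kappa> * (m * g - ln C) + ln (labs L) \<le> ln C + g" by linarith
        then have "g * (m * (1 + \<kappa>) - 1) \<le> (2 + \<kappa>) * ln C - ln (labs L)" by (simp add: algebra_simps)
        then have "g \<le> G2" unfolding G2_def using \<kappa>(2) by (subst pos_le_divide_eq) auto
        then show False using g(2) by simp
      qed
      then have "exp g \<le> exp (max G1 G2)" by simp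
      then show "mat_labs A \<le> exp (max G1 G2)" using A1 by (simp add: g_def)
    qed
  qed
next
  obtain c where c: "\<And>k. \<exists>A\<in>SL2. act A x \<noteq> y
    \<and> mat_labs A \<le> exp (c + n (Suc k) + n (Suc (Suc k)))
    \<and> vec_labs (act A x - y) \<le> exp (- (n (Suc (Suc k)) - c))"
    using rational_target[OF d y] by blast
  let ?\<omega> = "irrationality_exponent \<xi>"
  have *: "ereal m \<le> mu x y" if m: "0 < m" "ereal m < rational_slope_mu ?\<omega>" for m
  proof (rule le_mu[OF m(1)])
    fix G
    obtain w where w: "w > 0" "ereal w < ?\<omega>" "m * (w + 1) < w"
      using ereal_less_rational_slope_mu[OF irrationality_exponent_ge_1 m] by blast
    \<comment> \<open>Along the chosen indices the height exponent \<open>n k' + n (Suc k')\<close>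
      is at most \<open>(1 + 1 / w) * n (Suc k')\<close>.\<close>
    have lt: "m * (1 + 1 / w) < 1" using w by (simp add: field_simps)
    have n1: "filterlim (\<lambda>k. n (Suc k)) at_top sequentially"
      using n_Suc_at_top[of 1] by simp
    have "\<forall>\<^sub>F k in sequentially. m * (1 + 1 / w) * n (Suc k) + (m * c + c) \<le> 1 * n (Suc k)"
      by (rule eventually_linear_le[OF n1 lt])
    moreover have "\<forall>\<^sub>F k in sequentially. n (Suc k) \<ge> G + c"
      using n1 by (simp add: filterlim_at_top)
    \<comment> \<open>\<open>rational_target\<close> starts with the convergent of index
      \<open>Suc k\<close>, so index 0 is excluded.\<close>
    moreover have "\<forall>\<^sub>F k in sequentially. k \<ge> 1" by (rule eventually_ge_at_top)
    ultimately have "\<forall>\<^sub>F k in sequentially. m * (1 + 1 / w) * n (Suc k) + (m * c + c) \<le> 1 * n (Suc k)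
        \<and> n (Suc k) \<ge> G + c \<and> k \<ge> 1"
      by eventually_elim auto
    from frequently_eventually_conj[OF frequently_n_Suc_ge[OF w(2,1)] this]
    obtain k' where k': "w * n k' \<le> n (Suc k')" "k' \<ge> 1" "n (Suc k') \<ge> G + c"
      "m * (1 + 1 / w) * n (Suc k') + (m * c + c) \<le> 1 * n (Suc k')"
      by (auto dest!: frequently_ex)
    then obtain k where k: "k' = Suc k" by (cases k') auto
    have "n k' \<le> n (Suc k') / w" using k'(1) w by (simp add: field_simps)
    then have "m * n k' \<le> m * (n (Suc k') / w)" using m by (intro mult_left_mono) auto
    then have "m * (c + n (Suc k) + n (Suc (Suc k))) \<le> n (Suc (Suc k)) - c"
      using k'(4) unfolding k by (simp add: algebra_simps)
    moreover have "G \<le> n (Suc (Suc k)) - c" using k'(3) unfolding k by simp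
    ultimately show "\<exists>A\<in>SL2. \<exists>f g. g \<ge> G \<and> m * f \<le> g \<and> act A x \<noteq> y
      \<and> mat_labs A \<le> exp f \<and> vec_labs (act A x - y) \<le> exp (- g)"
      using c[of k] by blast
  qed
  have "0 < rational_slope_mu ?\<omega>"
    using irrationality_exponent_ge_1 by (cases ?\<omega>) (auto simp: rational_slope_mu_def one_ereal_def)
  then obtain m0 where "0 < ereal m0" "ereal m0 < rational_slope_mu ?\<omega>"
    using ereal_dense2 by blast
  then have "0 \<le> mu x y" using *[of m0] by (auto intro: order_trans[rotated])
  then show "rational_slope_mu ?\<omega> \<le> mu x y"
    by (rule le_ereal_positive_dense) (use * in auto)
qed

text \<open>Upper bound: at a small constant times \<open>N k * N (Suc k)\<close> the second row
  must be a multiple of the convergent \<open>k\<close>, and then \<open>pabs a\<close> equals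
  \<open>labs L * (N k * N (Suc k))\<close>, too large for that height. Lower bound: the next height
  exponent \<open>n (k + 2) + n (k + 3)\<close> is eventually at most
  \<open>(w + 1) * n (k + 2)\<close>, up to a constant.\<close>

theorem mu_hat_rational_slope:
  fixes y :: "'a fls ^ 2"
  assumes d: "p * s' - p' * s = 1"
    and y: "y $ 1 = \<theta> * poly_T p" "y $ 2 = \<theta> * poly_T s" and \<theta>: "\<theta> \<noteq> 0"
  shows "mu_hat x y = 1 / (irrationality_exponent \<xi> + 1)"
proof (rule antisym)
  show "mu_hat x y \<le> 1 / (irrationality_exponent \<xi> + 1)"
  proof (rule mu_hat_le)
    fix m assume "1 / (irrationality_exponent \<xi> + 1) < ereal m"
    then obtain w where w: "w > 0" "ereal w < irrationality_exponent \<xi>" "1 < m * (w + 1)"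
      using ereal_one_divide_plus_1_less[OF irrationality_exponent_ge_1] by blast
    have m: "m > 0" using w by (smt (verit) mult_nonpos_nonneg)
    define L where "L = \<theta> / x $ 2"
    have L: "labs L > 0" using \<theta> x2 by (simp add: L_def)
    obtain C where C: "C \<ge> 1" "\<And>A. A \<in> SL2 \<Longrightarrow> \<exists>a b c d. a * d - b * c = 1
      \<and> pabs a \<le> C * mat_labs A
      \<and> labs (poly_T a * \<xi> + poly_T b - L) \<le> C * vec_labs (act A x - y)
      \<and> labs (poly_T c * \<xi> + poly_T d) \<le> C * vec_labs (act A x - y)"
      using rational_target_coordinates[OF d y] unfolding L_def by blast
    \<comment> \<open>After the factor \<open>C\<close> of the coordinate change,
      \<open>pabs a\<close> is at most half of what the determinant demands.\<close>
    define q where "q = labs L / (2 * C)"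
    have q: "q > 0" "C * q = labs L / 2" using L C(1) by (auto simp: q_def)
    show "\<exists>\<^sub>F H in at_top. \<not> (\<exists>A\<in>SL2. mat_labs A \<le> H \<and> vec_labs (act A x - y) \<le> H powr (- m))"
    proof (rule ccontr)
      assume "\<not> ?thesis"
      then have ev: "\<forall>\<^sub>F H in at_top. \<exists>A\<in>SL2. mat_labs A \<le> H \<and> vec_labs (act A x - y) \<le> H powr (- m)"
        by (simp add: frequently_def)
      define h where "h k = ln q + (n k + n (Suc k))" for k
      have "filterlim (\<lambda>k. n k + n (Suc k)) at_top sequentially"
        using n_at_top n_Suc_at_top[of 1] by (intro filterlim_at_top_add_at_top) auto
      then have "filterlim h at_top sequentially"
        unfolding h_def by (rule filterlim_tendsto_add_at_top[OF tendsto_const])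
      then have "filterlim (\<lambda>k. exp (h k)) at_top sequentially"
        by (rule filterlim_compose[OF exp_at_top])
      then have "\<forall>\<^sub>F k in sequentially. \<exists>A\<in>SL2. mat_labs A \<le> exp (h k)
          \<and> vec_labs (act A x - y) \<le> exp (h k) powr (- m)"
        using ev by (rule eventually_compose_filterlim[rotated])
      moreover have "\<forall>\<^sub>F k in sequentially. 1 * n k + (ln C - m * ln q + 1) \<le> (m * (w + 1)) * n k"
        by (rule eventually_linear_le[OF n_at_top w(3)])
      moreover have "\<forall>\<^sub>F k in sequentially. n k > - ln (labs L)"
        using n_at_top by (simp add: filterlim_at_top_dense)
      ultimately have "\<forall>\<^sub>F k in sequentially. (\<exists>A\<in>SL2. mat_labs A \<le> exp (h k)
          \<and> vec_labs (act A x - y) \<le> exp (h k) powr (- m))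
          \<and> 1 * n k + (ln C - m * ln q + 1) \<le> (m * (w + 1)) * n k \<and> n k > - ln (labs L)"
        by (intro eventually_conj)
      from frequently_eventually_conj[OF frequently_n_Suc_ge[OF w(2,1)] this]
      obtain k A where k: "w * n k \<le> n (Suc k)"
        "1 * n k + (ln C - m * ln q + 1) \<le> (m * (w + 1)) * n k" "n k > - ln (labs L)"
        and A: "A \<in> SL2" "mat_labs A \<le> exp (h k)" "vec_labs (act A x - y) \<le> exp (h k) powr (- m)"
        by (auto dest!: frequently_ex)
      have NL: "1 < N k * labs L"
      proof -
        have "0 < ln (N k * labs L)" using k(3) N_pos[of k] L by (subst ln_mult) auto
        then show ?thesis using N_pos[of k] L by (subst (asm) ln_gt_zero_iff) auto
      qed
      define E where "E = C * exp (- (m * h k))"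
      have "N k * E = exp (n k + ln C - m * h k)"
        using C(1) by (simp add: E_def exp_add exp_diff exp_minus exp_n divide_inverse)
      moreover have "m * (w * n k) \<le> m * n (Suc k)" using k(1) m by simp
      then have "n k + ln C - m * h k < 0"
        using k(2) by (simp add: h_def algebra_simps)
      ultimately have NE: "N k * E < 1" by simp
      have E0: "E > 0" using C(1) by (simp add: E_def)
      have E1: "E < 1" using NE mult_right_mono[OF N_ge_1[of k], of E] E0 by linarith
      have "N k * E < N k * labs L" using NE NL by linarith
      then have EL: "E < labs L" using N_pos[of k] by (simp only: mult_less_cancel_left_pos)
      have vec: "C * vec_labs (act A x - y) \<le> E"
        using A(3) C(1) unfolding E_def by (simp add: powr_minus_eq_exp)
      have mat: "C * mat_labs A \<le> labs L / 2 * (N k * N (Suc k))"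
      proof -
        have "C * mat_labs A \<le> C * exp (h k)" using A(2) C(1) by simp
        also have "exp (h k) = q * (N k * N (Suc k))"
          using q by (simp add: h_def exp_add exp_n)
        also have "C * (q * (N k * N (Suc k))) = labs L / 2 * (N k * N (Suc k))"
          using q(2) by (simp only: mult.assoc[symmetric])
        finally show ?thesis .
      qed
      obtain a b c d where abcd: "a * d - b * c = 1" "pabs a \<le> labs L / 2 * (N k * N (Suc k))"
        "labs (poly_T a * \<xi> + poly_T b - L) \<le> E" "labs (poly_T c * \<xi> + poly_T d) \<le> E"
        using C(2)[OF A(1)] vec mat by (meson order_trans)
      define l where "l = poly_T c * \<xi> + poly_T d"
      have near: "labs (poly_T a * \<xi> + poly_T b - L) < labs L" "labs l < 1" and lE: "labs l \<le> E"
        using abcd EL E1 unfolding l_def by linarith+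
      note ax = unimodular_near_axis[OF abcd(1) near[unfolded l_def], folded l_def]
      \<comment> \<open>Aims at \<open>pabs c < N (Suc k)\<close> through the determinant equation;
        \<open>N k * E\<close> is the factor below 1.\<close>
      have "pabs a * labs l \<le> labs L / 2 * (N k * N (Suc k)) * E"
        using abcd(2) lE E0 L by (intro mult_mono) auto
      also have "\<dots> = labs L / 2 * N (Suc k) * (N k * E)" by simp
      also have "\<dots> \<le> labs L / 2 * N (Suc k) * 1"
        using NE by (intro mult_left_mono) auto
      also have "\<dots> < labs L * N (Suc k)" using L N_pos[of "Suc k"] by simp
      finally have "pabs a * labs l < N (Suc k) * labs L" by (simp add: mult.commute)
      moreover have "1 < N (Suc k) * labs L"
        using NL mult_strict_right_mono[OF Q_less[of k] L] by linarith
      ultimately have "pabs c * labs L < N (Suc k) * labs L" using ax(2) by linarith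
      then have "pabs c < N (Suc k)" using L by (simp only: mult_less_cancel_right_pos)
      then have "labs (poly_T c * eps k) < 1"
        using N_pos[of "Suc k"] by (simp add: labs_mult labs_eps)
      moreover have "N k * labs l \<le> N k * E" using lE by (intro mult_left_mono) auto
      then have "labs (poly_T (Q k) * (poly_T c * \<xi> + poly_T d)) < 1"
        using NE unfolding l_def by (simp add: labs_mult)
      ultimately obtain r where r: "c = r * Q k" "d = r * R k"
        using proportional_to_convergent by blast
      have r1: "pabs r \<ge> 1" using ax(1) r by (intro pabs_ge_1) auto
      have "l = poly_T r * eps k" by (simp add: l_def r eps_def poly_T_hom algebra_simps)
      then have l: "labs l = pabs r / N (Suc k)" by (simp add: labs_mult labs_eps)
      have pc: "pabs c = pabs r * N k" by (simp add: r poly_T_hom labs_mult)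
      have "1 * (N k * labs L) \<le> pabs r * (N k * labs L)"
        using r1 by (intro mult_right_mono) auto
      then have "1 < pabs c * labs L" using NL unfolding pc by (simp add: mult.assoc)
      then have "pabs a * labs l = pabs c * labs L" by (rule ax(3))
      \<comment> \<open>The unknown multiplier \<open>r\<close> scales both \<open>c\<close> and
        \<open>l\<close>, so it cancels and \<open>pabs a\<close> is determined.\<close>
      then have "pabs r * pabs a = pabs r * (labs L * (N k * N (Suc k)))"
        unfolding l pc using N_pos[of "Suc k"] by (simp add: field_simps)
      then have "pabs a = labs L * (N k * N (Suc k))" using r1 by auto
      moreover have "labs L * (N k * N (Suc k)) > 0" using L N_pos by (intro mult_pos_pos)
      ultimately show False using abcd(2) by simp
    qed
  qed
next
  obtain c where c: "\<And>k. \<exists>A\<in>SL2. act A x \<noteq> y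
    \<and> mat_labs A \<le> exp (c + n (Suc k) + n (Suc (Suc k)))
    \<and> vec_labs (act A x - y) \<le> exp (- (n (Suc (Suc k)) - c))"
    using rational_target[OF d y] by blast
  show "1 / (irrationality_exponent \<xi> + 1) \<le> mu_hat x y"
  proof (rule le_ereal_positive_dense[OF mu_hat_nonneg])
    fix m assume m: "m > 0" "ereal m < 1 / (irrationality_exponent \<xi> + 1)"
    obtain w where w: "w > 0" "irrationality_exponent \<xi> < ereal w" "m * (w + 1) < 1"
      using ereal_less_one_divide_plus_1[OF irrationality_exponent_ge_1 m] by blast
    have n1: "filterlim (\<lambda>k. n (Suc k)) at_top sequentially"
      and n2: "filterlim (\<lambda>k. n (Suc (Suc k))) at_top sequentially"
      using n_Suc_at_top[of 1] n_Suc_at_top[of 2] by simp_all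
    show "ereal m \<le> mu_hat x y"
    proof (rule le_mu_hat[OF m(1), where f = "\<lambda>k. c + n (Suc k) + n (Suc (Suc k))"
          and g = "\<lambda>k. n (Suc (Suc k)) - c"])
      show "filterlim (\<lambda>k. c + n (Suc k) + n (Suc (Suc k))) at_top sequentially"
        by (intro filterlim_at_top_add_at_top filterlim_tendsto_add_at_top[OF tendsto_const] n1 n2)
      show "\<forall>\<^sub>F k in sequentially. \<exists>A\<in>SL2. mat_labs A \<le> exp (c + n (Suc k) + n (Suc (Suc k)))
          \<and> vec_labs (act A x - y) \<le> exp (- (n (Suc (Suc k)) - c))"
        using c by (intro always_eventually) blast
      have "\<forall>\<^sub>F k in sequentially. n (Suc (Suc (Suc k))) \<le> w * n (Suc (Suc k))"
        using eventually_n_Suc_le[OF w(2)]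
        by (subst eventually_sequentially_Suc[of "\<lambda>k. n (Suc (Suc k)) \<le> w * n (Suc k)"],
            subst eventually_sequentially_Suc)
      moreover have "\<forall>\<^sub>F k in sequentially. (m * (w + 1)) * n (Suc (Suc k)) + (m * c + c) \<le> 1 * n (Suc (Suc k))"
        by (rule eventually_linear_le[OF n2 w(3)])
      ultimately show "\<forall>\<^sub>F k in sequentially.
          m * (c + n (Suc (Suc k)) + n (Suc (Suc (Suc k)))) \<le> n (Suc (Suc k)) - c"
      proof eventually_elim
        case (elim k)
        have "m * n (Suc (Suc (Suc k))) \<le> m * (w * n (Suc (Suc k)))" using elim(1) m(1) by simp
        then show ?case using elim(2) by (simp add: algebra_simps)
      qed
    qed
  qed
qed

end

section \<open>Reduced fractions and the three statements together\<close>

text \<open>The slope is put in lowest terms, and the Bezout coefficients complete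
  \<open>(p, s)\<close> to a matrix of determinant 1.\<close>

lemma rational_slope_coprime:
  fixes y :: "'a::{field,finite} fls ^ 2"
  assumes y2: "y $ 2 \<noteq> 0" and "y $ 1 / y $ 2 \<in> rational_functions"
  shows "\<exists>p s p' s' \<theta>. p * s' - p' * s = 1 \<and> y $ 1 = \<theta> * poly_T p \<and> y $ 2 = \<theta> * poly_T s \<and> \<theta> \<noteq> 0"
proof -
  obtain P Q where PQ: "y $ 1 / y $ 2 = poly_T P / poly_T Q" "Q \<noteq> 0"
    using assms(2) by (auto simp: rational_functions_def)
  \<comment> \<open>The ideal generated by \<open>P\<close> and \<open>Q\<close>. An element of
    least degree divides all others, since remainders stay in the ideal.\<close>
  define I where "I = {c. \<exists>a b. c = a * P + b * Q}"
  have "1 * P + 0 * Q \<in> I" "0 * P + 1 * Q \<in> I" unfolding I_def by blast+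
  then have I: "P \<in> I" "Q \<in> I" by simp_all
  then obtain g where g: "g \<in> I" "g \<noteq> 0" and min: "\<And>c. c \<in> I \<Longrightarrow> c \<noteq> 0 \<Longrightarrow> degree g \<le> degree c"
    using ex_has_least_nat[of "\<lambda>c. c \<in> I \<and> c \<noteq> 0" Q degree] PQ(2) by blast
  obtain a b where ab: "g = a * P + b * Q" using g(1) by (auto simp: I_def)
  have dvd: "g dvd c" if c: "c \<in> I" for c
  proof -
    obtain a' b' where "c = a' * P + b' * Q" using c by (auto simp: I_def)
    then have "c mod g = (a' - c div g * a) * P + (b' - c div g * b) * Q"
      by (simp add: minus_div_mult_eq_mod[symmetric] ab algebra_simps)
    then have "c mod g \<in> I" by (auto simp: I_def)
    then have "c mod g = 0"
      using min[of "c mod g"] degree_mod_less[OF g(2), of c] by (meson not_le)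
    then show ?thesis by (simp add: dvd_eq_mod_eq_0)
  qed
  obtain p s where ps: "P = g * p" "Q = g * s" using dvd[OF I(1)] dvd[OF I(2)] by (auto elim!: dvdE)
  have "g * (a * p + b * s) = g * 1" using ab ps by (simp add: algebra_simps)
  then have bez: "a * p + b * s = 1" using g(2) by (simp only: mult_cancel_left) simp
  have s0: "s \<noteq> 0" using ps PQ(2) by auto
  define \<theta> where "\<theta> = y $ 2 / poly_T s"
  have "y $ 1 = y $ 2 * (poly_T P / poly_T Q)" using PQ(1) y2 by (simp add: field_simps)
  also have "poly_T P / poly_T Q = poly_T p / poly_T s"
    using g(2) by (simp add: ps poly_T_mult)
  finally have "y $ 1 = \<theta> * poly_T p" by (simp add: \<theta>_def)
  moreover have "y $ 2 = \<theta> * poly_T s" "\<theta> \<noteq> 0" using s0 y2 by (simp_all add: \<theta>_def)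
  moreover have "p * a - (- b) * s = 1" using bez by (simp add: algebra_simps)
  ultimately show ?thesis by blast
qed

theorem theorem1p4:
  fixes x :: "'a::{field,finite} fls ^ 2" and \<xi> :: "'a fls"
  assumes "x $ 2 \<noteq> 0"
    and "\<xi> = x $ 1 / x $ 2"
    and "\<xi> \<notin> rational_functions"
  shows "(mu x 0 = 1 \<and> mu_hat x 0 = 1 / irrationality_exponent \<xi>)
    \<and> (\<forall>y :: 'a fls ^ 2. y $ 2 \<noteq> 0 \<longrightarrow> y $ 1 / y $ 2 \<in> rational_functions \<longrightarrow>
          mu x y = rational_slope_mu (irrationality_exponent \<xi>)
        \<and> mu_hat x y = 1 / (irrationality_exponent \<xi> + 1))
    \<and> (\<forall>y :: 'a fls ^ 2. y $ 2 \<noteq> 0 \<longrightarrow> y $ 1 / y $ 2 \<notin> rational_functions \<longrightarrow>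
          mu x y \<ge> 1 / 3
        \<and> mu_hat x y \<ge> irrational_slope_mu_hat_bound
              (irrationality_exponent \<xi>) (irrationality_exponent (y $ 1 / y $ 2))
        \<and> irrational_slope_mu_hat_bound
              (irrationality_exponent \<xi>) (irrationality_exponent (y $ 1 / y $ 2))
            \<ge> 1 / (4 * irrationality_exponent \<xi>))"
proof -
  obtain Q R where "convergents \<xi> Q R"
    using convergents_exist[OF assms(3)] by blast
  then interpret convergents \<xi> Q R .
  interpret convergents_vector \<xi> Q R x
    using assms(1,2) by unfold_locales auto
  show ?thesis
  proof (intro conjI allI impI)
    show "mu x 0 = 1" "mu_hat x 0 = 1 / irrationality_exponent \<xi>"
      by (rule mu_zero mu_hat_zero)+
  next
    fix y :: "'a fls ^ 2"
    assume "y $ 2 \<noteq> 0" "y $ 1 / y $ 2 \<in> rational_functions"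
    then obtain p s p' s' \<theta> where "p * s' - p' * s = 1" "y $ 1 = \<theta> * poly_T p" "y $ 2 = \<theta> * poly_T s" "\<theta> \<noteq> 0"
      using rational_slope_coprime by blast
    then show "mu x y = rational_slope_mu (irrationality_exponent \<xi>)"
      "mu_hat x y = 1 / (irrationality_exponent \<xi> + 1)"
      by (rule mu_rational_slope mu_hat_rational_slope)+
  next
    fix y :: "'a fls ^ 2"
    assume y2: "y $ 2 \<noteq> 0" and irr: "y $ 1 / y $ 2 \<notin> rational_functions"
    obtain Q' R' where conv: "convergents (y $ 1 / y $ 2) Q' R'"
      using convergents_exist[OF irr] by blast
    have y1: "y $ 1 = y $ 1 / y $ 2 * y $ 2" using y2 by simp
    show "1 / 3 \<le> mu x y"
      by (rule mu_irrational_slope[OF conv y2 y1])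
    show "irrational_slope_mu_hat_bound (irrationality_exponent \<xi>) (irrationality_exponent (y $ 1 / y $ 2))
        \<le> mu_hat x y"
      by (rule mu_hat_irrational_slope[OF conv y2 y1])
    show "1 / (4 * irrationality_exponent \<xi>) \<le> irrational_slope_mu_hat_bound
        (irrationality_exponent \<xi>) (irrationality_exponent (y $ 1 / y $ 2))"
      by (rule irrational_slope_bound_ge[OF irrationality_exponent_ge_1
            convergents.irrationality_exponent_ge_1[OF conv]])
  qed
qed

end
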